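(* Consider a signal $\mathbf{x}\in\mathbb{R}^n$ with measurements $\mathbf{y}=\frac1\Delta\mathbf{A}\mathbf{x}+\mathbf{w}$, quantized element-wise by $Q(y)=\lfloor y+\frac12\rfloor$, where $\Delta>0$, $\mathbf{A}\in\mathbb{R}^{m\times n}$ is randomly drawn with i.i.d. $\mathcal{N}(0,\sigma^2)$ entries, and the dither $\mathbf{w}\in\mathbb{R}^m$ has i.i.d. entries uniform on $[-1,0)$. Assume there exists a prediction $\widehat{\mathbf{x}}\in\mathbb{R}^n$ with prediction error $\epsilon=\|\mathbf{x}-\widehat{\mathbf{x}}\|_2$, and let $y=\frac1\Delta\langle\mathbf{a},\mathbf{x}\rangle+w$ and $\widehat y=\frac1\Delta\langle\mathbf{a},\widehat{\mathbf{x}}\rangle+w$ denote single measurements of $\mathbf{x}$ and $\widehat{\mathbf{x}}$, respectively, taken with the same row $\mathbf{a}$ of $\mathbf{A}$ and the same dither entry $w$. Assume also that the first $k-1$ least significant bits of $Q(y)$, namely $q_{(i)}$, $i=1,\ldots,k-1$, are perfectly known. Then the likelihood of error in $\widehat q_{(k)}$, the $k$-th bit predicted from $\widehat y$ and $q_{(1)},\ldots,q_{(k-1)}$ (as defined in the context), can be estimated from $\widehat y$ and $q_{(i)}$, $i=1,\ldots,k-1$, as $$L_k=\Pr\left(\widehat q_{(k)}\neq q_{(k)}\mid \widehat y,q_{(1)},\ldots,q_{(k-1)}\right)=\frac{A_2(k,c)}{A_1(k,c)+A_2(k,c)},$$ where $$A_1(k,c)=\frac1{2^k}\left(1+2\sum_{l=1}^{+\infty}e^{-\frac12\left(\frac{\pi\sigma\epsilon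 l}{2^{k-1}\Delta}\right)^2}\cos\!\left(\frac{\pi c l}{2^{k-1}}\right)\mathrm{sinc}\!\left(\frac{l}{2^k}\right)\right),\qquad A_2(k,c)=A_1(k,2^{k-1}-c),$$ and where $c$ is the smallest distance from $\widehat y$ to the center of a quantization interval consistent with the $k-1$ least significant bits $q_{(i)}$, $i=1,\ldots,k-1$.
   Context: $\mathrm{sinc}(u)=\frac{\sin(\pi u)}{\pi u}$ is the normalized sinc function. The vectors $\mathbf{x}$ and $\widehat{\mathbf{x}}$ are arbitrary and non-random; the randomness is in $\mathbf{A}$ and $\mathbf{w}$. Bits: $q_{(k)}$ denotes the $k$-th bit of the integer $q=Q(y)$, with $k=1$ the least significant bit, i.e. $q_{(k)}=\lfloor q/2^{k-1}\rfloor\bmod 2$ (negative integers as in two's complement). The quantizer is assumed to have enough bits that it does not saturate. Consistency and prediction: the quantization interval of an integer $j$ is $[j-\frac12,j+\frac12)$, with center $j$. It is consistent with $q_{(1)},\ldots,q_{(k-1)}$ if $j_{(i)}=q_{(i)}$ for $i=1,\ldots,k-1$ (every interval is consistent if $k=1$). Thus $c=\min\{|\widehat y-j| : j\text{ consistent}\}$. The predicted bit $\widehat q_{(k)}$ is the $k$-th bit $j^\star_{(k)}$ of the consistent integer $j^\star$ closest to $\widehat y$.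
   Formalization: Conditioning on all of ŷ, q_(1),…,q_(k−1) is proved only when ⟨x̂, x−x̂⟩=0 (it fails otherwise, e.g. n=1, x=0, x̂=1, σ=Δ=k=1); for general x, x̂ the formula is proved conditional on the signed offset of ŷ from the nearest consistent center, whose absolute value is c. *)

theory Defs
  imports "HOL-Probability.Probability"
begin

definition measurement :: "real \<Rightarrow> real^'n^'m \<Rightarrow> real^'m \<Rightarrow> real^'n \<Rightarrow> real^'m" where
  "measurement \<Delta> A w x = (1 / \<Delta>) *\<^sub>R (A *v x) + w"

definition quantize :: "real \<Rightarrow> int" where
  "quantize y = \<lfloor>y + 1/2\<rfloor>"

text \<open>Bits are numbered from 1, the least significant one.  Since \<open>div\<close> and \<open>mod\<close>
  on \<^typ>\<open>int\<close> round towards minus infinity, negative numbers are read in two's complement.\<close>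

definition kth_bit :: "nat \<Rightarrow> int \<Rightarrow> int" where
  "kth_bit k q = (q div 2 ^ (k - 1)) mod 2"

text \<open>Below, \<open>b i\<close> is the value of the \<open>i\<close>-th bit; only \<open>b 1, \<dots>, b (k - 1)\<close> are looked at.\<close>

definition consistent :: "nat \<Rightarrow> (nat \<Rightarrow> int) \<Rightarrow> int \<Rightarrow> bool" where
  "consistent k b j \<longleftrightarrow> (\<forall>i\<in>{1..<k}. kth_bit i j = b i)"

text \<open>If two consistent integers are equally close to \<open>yh\<close>, an unspecified one of them is taken.\<close>

definition closest_consistent :: "nat \<Rightarrow> real \<Rightarrow> (nat \<Rightarrow> int) \<Rightarrow> int" where
  "closest_consistent k yh b = (ARG_MIN (\<lambda>j. \<bar>yh - real_of_int j\<bar>) j. consistent k b j)"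

definition predicted_bit :: "nat \<Rightarrow> real \<Rightarrow> (nat \<Rightarrow> int) \<Rightarrow> int" where
  "predicted_bit k yh b = kth_bit k (closest_consistent k yh b)"

text \<open>The infimum is a minimum whenever some integer is consistent with \<open>b\<close>, as is always the case
  for \<open>b i \<in> {0, 1}\<close>.\<close>

definition consistent_dist :: "nat \<Rightarrow> real \<Rightarrow> (nat \<Rightarrow> int) \<Rightarrow> real" where
  "consistent_dist k yh b = (INF j\<in>{j. consistent k b j}. \<bar>yh - real_of_int j\<bar>)"

text \<open>\<^term>\<open>sinc\<close> is the unnormalized sinc function, equal to 1 at 0.\<close>

definition normalized_sinc :: "real \<Rightarrow> real" where
  "normalized_sinc u = sinc (pi * u)"

text \<open>The summand with index \<open>l\<close> is the term of the series for \<open>l + 1\<close>.\<close>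

definition A1 :: "real \<Rightarrow> real \<Rightarrow> real \<Rightarrow> nat \<Rightarrow> real \<Rightarrow> real" where
  "A1 \<sigma> \<epsilon> \<Delta> k c = 1 / 2 ^ k * (1 + 2 * (\<Sum>l.
     exp (- (1/2) * (pi * \<sigma> * \<epsilon> * real (Suc l) / (2 ^ (k - 1) * \<Delta>))\<^sup>2)
       * cos (pi * c * real (Suc l) / 2 ^ (k - 1))
       * normalized_sinc (real (Suc l) / 2 ^ k)))"

definition A2 :: "real \<Rightarrow> real \<Rightarrow> real \<Rightarrow> nat \<Rightarrow> real \<Rightarrow> real" where
  "A2 \<sigma> \<epsilon> \<Delta> k c = A1 \<sigma> \<epsilon> \<Delta> k (2 ^ (k - 1) - c)"

text \<open>The sigma-algebra generated by \<open>yh\<close> and the first \<open>k - 1\<close> bits.\<close>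

definition sigma_known :: "'w measure \<Rightarrow> nat \<Rightarrow> ('w \<Rightarrow> real) \<Rightarrow> ('w \<Rightarrow> nat \<Rightarrow> int) \<Rightarrow> 'w measure" where
  "sigma_known M k yh b =
     vimage_algebra (space M) (\<lambda>\<omega>. (yh \<omega>, \<lambda>i\<in>{1..<k}. b \<omega> i))
       (borel \<Otimes>\<^sub>M (\<Pi>\<^sub>M i\<in>{1..<k}. count_space UNIV))"

text \<open>The sub-sigma-algebra of \<^const>\<open>sigma_known\<close> generated by the signed offset of \<open>yh\<close> from the
  closest consistent interval center, i.e. by the position of \<open>yh\<close> relative to the consistent
  intervals.  The absolute value of the offset is \<^const>\<open>consistent_dist\<close>.  The distinction matters:
  \<open>y - quantize y\<close> is uniform and, thanks to the dither, independent of the Gaussian row; the offset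
  and the event that the predicted bit is wrong are (up to ties) functions of that variable and of
  \<open>y - yh\<close> alone.  In contrast, \<open>yh\<close> itself is in general correlated with \<open>y - yh\<close>.\<close>

definition sigma_offset :: "'w measure \<Rightarrow> nat \<Rightarrow> ('w \<Rightarrow> real) \<Rightarrow> ('w \<Rightarrow> nat \<Rightarrow> int) \<Rightarrow> 'w measure" where
  "sigma_offset M k yh b =
     vimage_algebra (space M) (\<lambda>\<omega>. yh \<omega> - real_of_int (closest_consistent k (yh \<omega>) (b \<omega>))) borel"

end

theory Submission
  imports Defs "HOL-Real_Asymp.Real_Asymp"
begin

text \<open>
  Write \<open>D = y - yhat\<close>, \<open>P = 2 ^ (k - 1)\<close>, \<open>N = 2 P\<close>, and let \<open>U\<close> be a variable that is independent of the
  prediction error \<open>D\<close>.  Whether \<open>quantize (U + D)\<close> is congruent to \<open>\<rho>\<close> modulo \<open>N\<close> is the value at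
  \<open>U + D - \<rho>\<close> of the \<open>N\<close>-periodic indicator of \<open>[-1/2, 1/2)\<close>.  Its Fourier partial sums are
  differences of two sawtooth sums, hence boundedly convergent, and averaging them over \<open>D\<close> multiplies
  the \<open>l\<close>-th term by the characteristic function of \<open>D\<close>, which yields \<open>A1\<close>; so \<open>A1 (U - \<rho>)\<close> is the
  conditional probability of the residue \<open>\<rho>\<close> given \<open>U\<close>, even when \<open>\<epsilon> = 0\<close> and the series converges
  only conditionally.  Two residues \<open>\<rho>\<close>, \<open>\<rho> + P\<close> share the known bits, have weights \<open>A1 c\<close> and
  \<open>A2 c\<close> in some order, and the prediction picks the one with weight \<open>A1 c\<close>, so Bayes' rule gives
  the likelihood.

  If \<open>xhat\<close> is orthogonal to \<open>x - xhat\<close>, one takes \<open>U = yhat\<close>.  In general one takes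
  \<open>U = frac yhat\<close>, which the dither makes uniform and independent of \<open>D\<close>; it determines the offset
  because error and offset are unchanged when \<open>y\<close> and \<open>yhat\<close> are translated by the same integer.
\<close>

section \<open>The sawtooth series\<close>

definition saw_sum :: "nat \<Rightarrow> real \<Rightarrow> real" where
  "saw_sum L \<theta> = (\<Sum>l<L. sin (real (Suc l) * \<theta>) / real (Suc l))"

text \<open>The sum of floor and ceiling makes \<open>saw\<close> vanish at its jumps, as the series does.\<close>

definition saw :: "real \<Rightarrow> real" where
  "saw \<theta> = pi / 2 * (of_int \<lfloor>\<theta> / (2 * pi)\<rfloor> + of_int \<lceil>\<theta> / (2 * pi)\<rceil>) - \<theta> / 2"

text \<open>The factor \<open>2 * sin (t / 2)\<close> turns each cosine into a difference of sines
  at neighbouring half-integer multiples of \<open>t\<close>, so the sum telescopes. Without a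
  division the identity also covers the zeros of \<open>sin (t / 2)\<close>.\<close>

lemma dirichlet_kernel:
  "2 * sin (t / 2) * (1 / 2 + (\<Sum>l<L. cos (real (Suc l) * t))) = sin ((real L + 1 / 2) * t)"
proof (induction L)
  case (Suc L)
  have "2 * sin (t / 2) * cos (real (Suc L) * t) = sin (real (Suc L) * t + t / 2) - sin (real (Suc L) * t - t / 2)"
    by (simp add: sin_add sin_diff)
  moreover have "real (Suc L) * t + t / 2 = (real (Suc L) + 1 / 2) * t" "real (Suc L) * t - t / 2 = (real L + 1 / 2) * t"
    by (simp_all add: algebra_simps)
  ultimately show ?case using Suc by (simp add: algebra_simps)
qed simp

lemma saw_sum_0 [simp]: "saw_sum L 0 = 0"
  by (simp add: saw_sum_def)

lemma saw_sum_minus: "saw_sum L (- \<theta>) = - saw_sum L \<theta>"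
  by (simp add: saw_sum_def sum_negf)

lemma saw_sum_periodic: "saw_sum L (\<theta> + 2 * pi * of_int n) = saw_sum L \<theta>"
proof -
  have "sin (real (Suc l) * (\<theta> + 2 * pi * of_int n)) = sin (real (Suc l) * \<theta>)" for l
  proof -
    have "real (Suc l) * (\<theta> + 2 * pi * of_int n) = real (Suc l) * \<theta> + of_int (int (Suc l) * n) * (2 * pi)"
      by (simp add: algebra_simps)
    then show ?thesis
      using sin.plus_of_int[of "real (Suc l) * \<theta>" "int (Suc l) * n"]
      by (simp only: of_real_eq_id id_apply)
  qed
  then show ?thesis by (simp add: saw_sum_def)
qed

text \<open>Since \<open>|sin x| \<le> |x|\<close>, every term is at most \<open>|\<theta>|\<close>.
  This serves arguments up to \<open>1 / L\<close>, where the remainder estimate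
  \<open>saw_sum_approx\<close> degenerates.\<close>

lemma abs_saw_sum_le: "\<bar>saw_sum L \<theta>\<bar> \<le> real L * \<bar>\<theta>\<bar>"
proof -
  have "\<bar>sin (real (Suc l) * \<theta>) / real (Suc l)\<bar> \<le> \<bar>\<theta>\<bar>" for l
    using abs_sin_x_le_abs_x[of "real (Suc l) * \<theta>"]
    by (simp add: abs_mult pos_divide_le_eq mult.commute del: of_nat_Suc)
  then have "\<bar>saw_sum L \<theta>\<bar> \<le> (\<Sum>l<L. \<bar>\<theta>\<bar>)"
    unfolding saw_sum_def by (intro order.trans[OF sum_abs] sum_mono) auto
  then show ?thesis by simp
qed

text \<open>Adding \<open>cos ((L + 1/2) t) / ((2 L + 1) sin (t / 2))\<close> to the error cancels the Dirichlet kernel in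
  its derivative; what is left is dominated by the derivative of \<open>cot (t / 2) / (2 L + 1)\<close>, and both
  functions vanish at \<open>pi\<close>.\<close>

lemma saw_sum_approx:
  assumes "0 < \<theta>" "\<theta> \<le> pi"
  shows "\<bar>saw_sum L \<theta> - (pi - \<theta>) / 2\<bar> \<le> 2 / ((2 * real L + 1) * sin (\<theta> / 2))"
proof -
  define m where "m = 2 * real L + 1"
  have m: "m > 0" by (simp add: m_def)
  define F where "F t = saw_sum L t - (pi - t) / 2 + cos (m / 2 * t) / (m * sin (t / 2))" for t
  define K where "K t = cos (t / 2) / (m * sin (t / 2))" for t
  define F' where "F' t = - cos (m / 2 * t) * cos (t / 2) / (2 * m * (sin (t / 2))\<^sup>2)" for t
  define K' where "K' t = - 1 / (2 * m * (sin (t / 2))\<^sup>2)" for t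
  have spos: "sin (t / 2) > 0" if "\<theta> \<le> t" "t \<le> pi" for t
    using that assms by (intro sin_gt_zero) auto
  have dF: "(F has_real_derivative F' t) (at t)" if t: "\<theta> \<le> t" "t \<le> pi" for t
  proof -
    note sp = spos[OF t]
    have "(saw_sum L has_real_derivative (\<Sum>l<L. cos (real (Suc l) * t))) (at t)"
      unfolding saw_sum_def[abs_def]
      by (auto intro!: derivative_eq_intros sum.cong simp del: of_nat_Suc)
    moreover have "(\<Sum>l<L. cos (real (Suc l) * t)) = sin (m / 2 * t) / (2 * sin (t / 2)) - 1 / 2"
      using dirichlet_kernel[of t L] sp by (simp add: m_def field_simps)
    ultimately have "(saw_sum L has_real_derivative (sin (m / 2 * t) / (2 * sin (t / 2)) - 1 / 2)) (at t)"
      by simp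
    moreover have "((\<lambda>t. cos (m / 2 * t) / (m * sin (t / 2))) has_real_derivative
        (- sin (m / 2 * t) * (m / 2) * (m * sin (t / 2)) - cos (m / 2 * t) * (m * (cos (t / 2) * (1 / 2))))
          / (m * sin (t / 2) * (m * sin (t / 2)))) (at t)"
      using sp m by (auto intro!: derivative_eq_intros)
    moreover have "(- sin (m / 2 * t) * (m / 2) * (m * sin (t / 2)) - cos (m / 2 * t) * (m * (cos (t / 2) * (1 / 2))))
          / (m * sin (t / 2) * (m * sin (t / 2))) = - sin (m / 2 * t) / (2 * sin (t / 2)) + F' t"
      unfolding F'_def using sp m by (simp add: divide_simps power2_eq_square) (simp add: algebra_simps)
    ultimately have "((\<lambda>t. (saw_sum L t - (pi - t) / 2) + cos (m / 2 * t) / (m * sin (t / 2))) has_real_derivative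
        (sin (m / 2 * t) / (2 * sin (t / 2)) - 1 / 2 - (0 - 1) / 2) + (- sin (m / 2 * t) / (2 * sin (t / 2)) + F' t)) (at t)"
      by (intro DERIV_add DERIV_diff DERIV_cdivide DERIV_const DERIV_ident) simp_all
    moreover have "(sin (m / 2 * t) / (2 * sin (t / 2)) - 1 / 2 - (0 - 1) / 2) + (- sin (m / 2 * t) / (2 * sin (t / 2)) + F' t) = F' t"
      by simp
    moreover have "F = (\<lambda>t. (saw_sum L t - (pi - t) / 2) + cos (m / 2 * t) / (m * sin (t / 2)))"
      by (rule ext) (rule F_def)
    ultimately show ?thesis by metis
  qed
  have dK: "(K has_real_derivative K' t) (at t)" if t: "\<theta> \<le> t" "t \<le> pi" for t
  proof -
    note sp = spos[OF t]
    have "((\<lambda>t. cos (t / 2) / (m * sin (t / 2))) has_real_derivative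
        (- sin (t / 2) * (1 / 2) * (m * sin (t / 2)) - cos (t / 2) * (m * (cos (t / 2) * (1 / 2))))
          / (m * sin (t / 2) * (m * sin (t / 2)))) (at t)"
      using sp m by (auto intro!: derivative_eq_intros)
    moreover have "(- sin (t / 2) * (1 / 2) * (m * sin (t / 2)) - cos (t / 2) * (m * (cos (t / 2) * (1 / 2))))
          / (m * sin (t / 2) * (m * sin (t / 2)))
        = (- (sin (t/2) * sin (t/2)) - cos (t/2) * cos (t/2)) / (2 * m * (sin (t / 2))\<^sup>2)"
      using sp m by (simp add: divide_simps power2_eq_square) (simp add: algebra_simps)
    ultimately have "(K has_real_derivative (- (sin (t/2) * sin (t/2)) - cos (t/2) * cos (t/2)) / (2 * m * (sin (t / 2))\<^sup>2)) (at t)"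
      by (simp add: K_def[abs_def])
    moreover have "- (sin (t/2) * sin (t/2)) - cos (t/2) * cos (t/2) = - 1"
      using sin_cos_squared_add3[of "t/2"] by linarith
    ultimately show ?thesis by (simp add: K'_def)
  qed
  have bd: "\<bar>F' t\<bar> \<le> - K' t" if t: "\<theta> \<le> t" "t \<le> pi" for t
  proof -
    have "\<bar>cos (m / 2 * t) * cos (t / 2)\<bar> \<le> 1 * 1"
      unfolding abs_mult by (intro mult_mono) auto
    then show ?thesis using spos[OF t] m
      by (simp add: F'_def K'_def abs_mult abs_divide divide_right_mono)
  qed
  \<comment> \<open>By \<open>bd\<close>, \<open>F + K\<close> is nonincreasing and
    \<open>F - K\<close> nondecreasing, so the values at \<open>pi\<close> bound
    \<open>F \<theta>\<close> on both sides by \<open>K \<theta>\<close>.\<close>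
  have "F \<theta> + K \<theta> \<ge> F pi + K pi"
  proof (rule DERIV_nonpos_imp_nonincreasing[OF assms(2)])
    fix t assume t: "\<theta> \<le> t" "t \<le> pi"
    have "((\<lambda>t. F t + K t) has_real_derivative (F' t + K' t)) (at t)"
      by (intro DERIV_add dF dK t)
    then show "\<exists>y. ((\<lambda>t. F t + K t) has_real_derivative y) (at t) \<and> y \<le> 0"
      using bd[OF t] by (intro exI[of _ "F' t + K' t"]) auto
  qed
  moreover have "F \<theta> - K \<theta> \<le> F pi - K pi"
  proof (rule DERIV_nonneg_imp_nondecreasing[OF assms(2)])
    fix t assume t: "\<theta> \<le> t" "t \<le> pi"
    have "((\<lambda>t. F t - K t) has_real_derivative (F' t - K' t)) (at t)"
      by (intro DERIV_diff dF dK t)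
    then show "\<exists>y. ((\<lambda>t. F t - K t) has_real_derivative y) (at t) \<and> 0 \<le> y"
      using bd[OF t] by (intro exI[of _ "F' t - K' t"]) auto
  qed
  moreover have "F pi = 0"
  proof -
    have "m / 2 * pi = of_int (int L) * pi + pi / 2" by (simp add: m_def field_simps)
    then have "cos (m / 2 * pi) = cos (of_int (int L) * pi + pi / 2)" by (rule arg_cong)
    then have "cos (m / 2 * pi) = 0" by (simp add: cos_add)
    moreover have "saw_sum L pi = 0"
      unfolding saw_sum_def by (intro sum.neutral) (simp del: of_nat_Suc)
    ultimately show ?thesis by (simp add: F_def)
  qed
  moreover have "K pi = 0" by (simp add: K_def)
  ultimately have "\<bar>F \<theta>\<bar> \<le> K \<theta>" by linarith
  also have "K \<theta> \<le> 1 / (m * sin (\<theta> / 2))"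
    using spos[of \<theta>] assms m by (auto simp: K_def intro!: divide_right_mono)
  finally have "\<bar>F \<theta>\<bar> \<le> 1 / (m * sin (\<theta> / 2))" .
  moreover have "\<bar>cos (m / 2 * \<theta>) / (m * sin (\<theta> / 2))\<bar> \<le> 1 / (m * sin (\<theta> / 2))"
    using spos[of \<theta>] assms m by (auto simp: abs_mult intro!: divide_right_mono)
  \<comment> \<open>One share of the bound is for \<open>F\<close>, the other for the correction
    term that was added to form it.\<close>
  ultimately have "\<bar>saw_sum L \<theta> - (pi - \<theta>) / 2\<bar> \<le> 1 / (m * sin (\<theta> / 2)) + 1 / (m * sin (\<theta> / 2))"
    unfolding F_def using abs_triangle_ineq4[of "saw_sum L \<theta> - (pi - \<theta>) / 2 + cos (m / 2 * \<theta>) / (m * sin (\<theta> / 2))" "cos (m / 2 * \<theta>) / (m * sin (\<theta> / 2))"]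
    by (simp only: add_diff_cancel_right') argo
  also have "1 / (m * sin (\<theta> / 2)) + 1 / (m * sin (\<theta> / 2)) = 2 / ((2 * real L + 1) * sin (\<theta> / 2))"
    unfolding m_def by simp
  finally show ?thesis .
qed

lemma saw_sum_reduce:
  obtains n :: int and \<tau> where "\<theta> = \<tau> + 2 * pi * of_int n" "\<bar>\<tau>\<bar> \<le> pi"
proof
  let ?n = "round (\<theta> / (2 * pi))"
  show "\<theta> = (\<theta> - 2 * pi * of_int ?n) + 2 * pi * of_int ?n" by simp
  have "\<bar>of_int ?n - \<theta> / (2 * pi)\<bar> \<le> 1 / 2" by (rule of_int_round_abs_le)
  then show "\<bar>\<theta> - 2 * pi * of_int ?n\<bar> \<le> pi" by (simp add: abs_le_iff field_simps)
qed

text \<open>A crude form of Jordan's inequality. Up to \<open>pi / 3\<close> the derivative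
  \<open>cos t - 1 / 4\<close> is nonnegative; beyond, the sine is at least \<open>1 / 2\<close>
  while \<open>x / 4 \<le> pi / 8 < 1 / 2\<close>.\<close>

lemma sin_ge_linear:
  assumes "0 \<le> x" "x \<le> pi / 2"
  shows "sin x \<ge> x / 4"
proof (cases "x \<le> pi / 3")
  case True
  have "sin 0 - 0 / 4 \<le> sin x - x / 4"
  proof (rule DERIV_nonneg_imp_nondecreasing[OF assms(1)])
    fix t assume t: "0 \<le> t" "t \<le> x"
    have "cos t \<ge> cos (pi / 3)" using t True by (intro cos_monotone_0_pi_le) auto
    then have "cos t - 1 / 4 \<ge> 0" by (simp add: cos_60)
    moreover have "((\<lambda>t. sin t - t / 4) has_real_derivative (cos t - 1 / 4)) (at t)"
      by (auto intro!: derivative_eq_intros)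
    ultimately show "\<exists>y. ((\<lambda>t. sin t - t / 4) has_real_derivative y) (at t) \<and> 0 \<le> y" by blast
  qed
  then show ?thesis by simp
next
  case False
  have "sin (pi / 6) \<le> sin x" using False assms by (intro sin_monotone_2pi_le) auto
  then show ?thesis using assms pi_less_4 by (simp add: sin_30)
qed

text \<open>Uniformity in both \<open>L\<close> and \<open>\<theta>\<close> is what dominated
  convergence needs later. For \<open>L * \<theta> \<le> 1\<close> the termwise bound gives 1;
  otherwise \<open>sin (\<theta> / 2) \<ge> \<theta> / 8\<close> makes the remainder at most 8, next
  to a limit below 2. The constant 20 is generous.\<close>

lemma saw_sum_bounded: "\<bar>saw_sum L \<theta>\<bar> \<le> 20"
proof -
  have pos: "\<bar>saw_sum L \<theta>\<bar> \<le> 20" if t: "0 < \<theta>" "\<theta> \<le> pi" for \<theta>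
  proof (cases "real L * \<theta> \<le> 1")
    case True
    then show ?thesis using abs_saw_sum_le[of L \<theta>] t by simp
  next
    case False
    have "sin (\<theta> / 2) \<ge> \<theta> / 8" using sin_ge_linear[of "\<theta> / 2"] t by simp
    then have "(2 * real L + 1) * sin (\<theta> / 2) \<ge> (2 * real L + 1) * (\<theta> / 8)"
      by (intro mult_left_mono) auto
    also have "(2 * real L + 1) * (\<theta> / 8) \<ge> 1 / 4" using False t by (simp add: algebra_simps)
    finally have "2 / ((2 * real L + 1) * sin (\<theta> / 2)) \<le> 2 / (1 / 4)"
      by (intro divide_left_mono) auto
    then have "2 / ((2 * real L + 1) * sin (\<theta> / 2)) \<le> 8" by simp
    then have "\<bar>saw_sum L \<theta> - (pi - \<theta>) / 2\<bar> \<le> 8" by (rule order.trans[OF saw_sum_approx[OF t]])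
    then show ?thesis using t pi_less_4 by argo
  qed
  obtain n :: int and \<tau> where n: "\<theta> = \<tau> + 2 * pi * of_int n" "\<bar>\<tau>\<bar> \<le> pi"
    by (rule saw_sum_reduce)
  show ?thesis
    unfolding n(1) saw_sum_periodic using pos[of \<tau>] pos[of "- \<tau>"] n(2)
    by (cases "\<tau> = 0"; cases "\<tau> > 0") (auto simp: saw_sum_minus)
qed

lemma saw_periodic: "saw (\<theta> + 2 * pi * of_int n) = saw \<theta>"
proof -
  have "(\<theta> + 2 * pi * of_int n) / (2 * pi) = \<theta> / (2 * pi) + of_int n"
    by (simp add: field_simps)
  then show ?thesis unfolding saw_def by (simp only: floor_add_int ceiling_add_of_int) (simp add: algebra_simps)
qed

lemma saw_minus: "saw (- \<theta>) = - saw \<theta>"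
  unfolding saw_def minus_divide_left[symmetric] floor_minus ceiling_minus by (simp add: algebra_simps)

text \<open>For fixed \<open>\<theta>\<close> in \<open>(0, pi]\<close> the remainder of
  \<open>saw_sum_approx\<close> is of order \<open>1 / L\<close>; oddness and periodicity reduce all
  other arguments to this case or to 0.\<close>

lemma saw_sum_tendsto: "(\<lambda>L. saw_sum L \<theta>) \<longlonglongrightarrow> saw \<theta>"
proof -
  have pos: "(\<lambda>L. saw_sum L \<theta>) \<longlonglongrightarrow> saw \<theta>" if t: "0 < \<theta>" "\<theta> \<le> pi" for \<theta>
  proof -
    have "0 \<le> \<theta> / (2 * pi)" "\<theta> / (2 * pi) < 1" "0 < \<theta> / (2 * pi)" "\<theta> / (2 * pi) \<le> 1"
      using t pi_gt_zero by (auto simp: field_simps)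
    then have "\<lfloor>\<theta> / (2 * pi)\<rfloor> = 0" "\<lceil>\<theta> / (2 * pi)\<rceil> = 1"
      by (simp_all add: floor_eq_iff ceiling_eq_iff)
    then have s: "saw \<theta> = (pi - \<theta>) / 2" by (simp add: saw_def field_simps)
    have sp: "sin (\<theta> / 2) > 0" using t by (intro sin_gt_zero) auto
    have "(\<lambda>L. 2 / ((2 * real L + 1) * sin (\<theta> / 2))) \<longlonglongrightarrow> 0"
      using sp by real_asymp
    then have "(\<lambda>L. saw_sum L \<theta> - (pi - \<theta>) / 2) \<longlonglongrightarrow> 0"
      by (rule Lim_null_comparison[rotated]) (use saw_sum_approx[OF t] in auto)
    then show ?thesis unfolding s by (rule LIM_zero_cancel)
  qed
  obtain n :: int and \<tau> where n: "\<theta> = \<tau> + 2 * pi * of_int n" "\<bar>\<tau>\<bar> \<le> pi"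
    by (rule saw_sum_reduce)
  consider "\<tau> = 0" | "\<tau> > 0" | "\<tau> < 0" by linarith
  then show ?thesis
  proof cases
    case 1
    then show ?thesis unfolding n(1) saw_sum_periodic saw_periodic by (simp add: saw_def)
  next
    case 2
    then show ?thesis using pos[of \<tau>] n(2) unfolding n(1) saw_sum_periodic saw_periodic by simp
  next
    case 3
    then have "(\<lambda>L. - saw_sum L (- \<tau>)) \<longlonglongrightarrow> - saw (- \<tau>)" using pos[of "- \<tau>"] n(2) by (intro tendsto_minus) simp
    then show ?thesis unfolding n(1) saw_sum_periodic saw_periodic by (simp add: saw_sum_minus saw_minus)
  qed
qed

section \<open>The periodized interval indicator\<close>

text \<open>The partial sums of \<^const>\<open>A1\<close> for \<open>\<epsilon> = 0\<close>, and their limit, which is \<open>1/2\<close> at the jumps.\<close>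

definition unit_box_sum :: "nat \<Rightarrow> nat \<Rightarrow> real \<Rightarrow> real" where
  "unit_box_sum k L v = 1 / 2 ^ k * (1 + 2 * (\<Sum>l<L. cos (pi * v * real (Suc l) / 2 ^ (k - 1))
     * normalized_sinc (real (Suc l) / 2 ^ k)))"

definition unit_box :: "nat \<Rightarrow> real \<Rightarrow> real" where
  "unit_box k v = (of_int \<lfloor>(v + 1 / 2) / 2 ^ k\<rfloor> + of_int \<lceil>(v + 1 / 2) / 2 ^ k\<rceil>
     - of_int \<lfloor>(v - 1 / 2) / 2 ^ k\<rfloor> - of_int \<lceil>(v - 1 / 2) / 2 ^ k\<rceil>) / 2"

lemma power_eq_double: "k \<ge> 1 \<Longrightarrow> (2::'a::comm_semiring_1) ^ k = 2 * 2 ^ (k - 1)"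
  by (cases k) auto

text \<open>The sinc factor is \<open>sin b / b\<close>, and
  \<open>2 * cos a * sin b = sin (a + b) - sin (a - b)\<close> splits each term into two sawtooth
  terms, one for each end of the unit interval.\<close>

lemma unit_box_sum_eq_saw_sum:
  assumes "k \<ge> 1"
  shows "unit_box_sum k L v = 1 / 2 ^ k
    + 1 / pi * (saw_sum L (2 * pi * ((v + 1 / 2) / 2 ^ k)) - saw_sum L (2 * pi * ((v - 1 / 2) / 2 ^ k)))"
proof -
  define N :: real where "N = 2 ^ k"
  have N: "N > 0" "2 ^ (k - 1) = N / 2" using power_eq_double[OF assms, where ?'a = real] by (auto simp: N_def)
  have "2 / N * (cos (pi * v * real (Suc l) / (N / 2)) * normalized_sinc (real (Suc l) / N))
      = 1 / pi * (sin (real (Suc l) * (2 * pi * ((v + 1 / 2) / N))) / real (Suc l)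
        - sin (real (Suc l) * (2 * pi * ((v - 1 / 2) / N))) / real (Suc l))" for l
  proof -
    define a where "a = pi * v * real (Suc l) / (N / 2)"
    define b where "b = pi * (real (Suc l) / N)"
    have 1: "real (Suc l) * (2 * pi * ((v + 1 / 2) / N)) = a + b"
      and 2: "real (Suc l) * (2 * pi * ((v - 1 / 2) / N)) = a - b"
      using N by (simp_all add: a_def b_def field_simps)
    have b: "b \<noteq> 0" using N by (simp add: b_def)
    have "2 / N * (cos a * (sin b / b)) = 1 / pi * ((2 * cos a * sin b) / real (Suc l))"
      using b N by (simp add: b_def field_simps)
    also have "2 * cos a * sin b = sin (a + b) - sin (a - b)" by (simp add: sin_add sin_diff)
    finally show ?thesis using b unfolding 1 2 normalized_sinc_def b_def[symmetric] a_def[symmetric]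
      by (simp add: diff_divide_distrib)
  qed
  then have "(\<Sum>l<L. 2 / N * (cos (pi * v * real (Suc l) / (N / 2)) * normalized_sinc (real (Suc l) / N)))
    = (\<Sum>l<L. 1 / pi * (sin (real (Suc l) * (2 * pi * ((v + 1 / 2) / N))) / real (Suc l)
        - sin (real (Suc l) * (2 * pi * ((v - 1 / 2) / N))) / real (Suc l)))"
    by (intro sum.cong refl)
  then show ?thesis
    unfolding unit_box_sum_def saw_sum_def N_def[symmetric] N(2) sum_subtractf[symmetric]
      sum_distrib_left[symmetric] by (simp add: distrib_left)
qed

lemma unit_box_sum_tendsto:
  assumes "k \<ge> 1"
  shows "(\<lambda>L. unit_box_sum k L v) \<longlonglongrightarrow> unit_box k v"
proof -
  let ?a = "(v + 1 / 2) / 2 ^ k" and ?b = "(v - 1 / 2) / 2 ^ k"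
  have s: "saw (2 * pi * x) = pi / 2 * (of_int \<lfloor>x\<rfloor> + of_int \<lceil>x\<rceil>) - pi * x" for x
    by (simp add: saw_def)
  have "(\<lambda>L. unit_box_sum k L v) \<longlonglongrightarrow> 1 / 2 ^ k + 1 / pi * (saw (2 * pi * ?a) - saw (2 * pi * ?b))"
    unfolding unit_box_sum_eq_saw_sum[OF assms] by (intro tendsto_intros saw_sum_tendsto)
  also have "1 / 2 ^ k + 1 / pi * (saw (2 * pi * ?a) - saw (2 * pi * ?b)) = unit_box k v"
  proof -
    \<comment> \<open>The linear parts of the two sawtooths cancel the constant Fourier coefficient,
      leaving only floors and ceilings.\<close>
    have "1 / 2 ^ k = ?a - ?b" by (simp add: diff_divide_distrib[symmetric])
    then show ?thesis unfolding s unit_box_def by (simp add: field_simps)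
  qed
  finally show ?thesis .
qed

text \<open>Two sawtooth sums contribute at most 20 each and the constant term at most 1; 41 is the
  dominating constant from here on.\<close>

lemma abs_unit_box_sum_le:
  assumes "k \<ge> 1"
  shows "\<bar>unit_box_sum k L v\<bar> \<le> 41"
proof -
  let ?a = "saw_sum L (2 * pi * ((v + 1 / 2) / 2 ^ k))" and ?b = "saw_sum L (2 * pi * ((v - 1 / 2) / 2 ^ k))"
  have "\<bar>?a - ?b\<bar> \<le> 40"
    using saw_sum_bounded[of L "2 * pi * ((v + 1 / 2) / 2 ^ k)"] saw_sum_bounded[of L "2 * pi * ((v - 1 / 2) / 2 ^ k)"]
    by linarith
  then have "\<bar>1 / pi * (?a - ?b)\<bar> \<le> 1 * 40"
    unfolding abs_mult using pi_ge_two by (intro mult_mono) (auto simp: field_simps)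
  moreover have "0 \<le> (1::real) / 2 ^ k" "(1::real) / 2 ^ k \<le> 1" by simp_all
  ultimately show ?thesis unfolding unit_box_sum_eq_saw_sum[OF assms] by linarith
qed

lemma unit_box_nonneg: "unit_box k v \<ge> 0"
proof -
  have "(v - 1 / 2) / 2 ^ k \<le> (v + 1 / 2) / 2 ^ k" by (intro divide_right_mono) auto
  then have "\<lfloor>(v - 1 / 2) / 2 ^ k\<rfloor> \<le> \<lfloor>(v + 1 / 2) / 2 ^ k\<rfloor>" "\<lceil>(v - 1 / 2) / 2 ^ k\<rceil> \<le> \<lceil>(v + 1 / 2) / 2 ^ k\<rceil>"
    by (auto intro: floor_mono ceiling_mono)
  then show ?thesis by (simp add: unit_box_def)
qed

text \<open>Away from the jumps each ceiling is its floor plus 1, so the value is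
  \<open>(q - \<rho>) div N - (q - \<rho> - 1) div N\<close> with \<open>q = quantize y\<close> and
  \<open>N = 2 ^ k\<close>. The quotient steps up exactly on reaching a multiple of
  \<open>N\<close>.\<close>

lemma unit_box_eq_indicator:
  assumes "y + 1 / 2 \<notin> \<int>" "k \<ge> 1"
  shows "unit_box k (y - of_int \<rho>) = of_bool (quantize y mod 2 ^ k = \<rho> mod 2 ^ k)"
proof -
  define q where "q = quantize y"
  define N :: int where "N = 2 ^ k"
  have N: "N \<ge> 2" using power_eq_double[OF assms(2), where ?'a = int] by (simp add: N_def)
  have nonint: "x / of_int N \<notin> \<int>" if "x \<notin> \<int>" for x :: real
  proof
    assume "x / of_int N \<in> \<int>"
    then have "x / of_int N * of_int N \<in> \<int>" by (intro Ints_mult) auto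
    then show False using that N by simp
  qed
  have ceil: "\<lceil>x\<rceil> = \<lfloor>x\<rfloor> + 1" if "x \<notin> \<int>" for x :: real
    using that by (simp add: ceiling_altdef) (metis Ints_of_int)
  have "y - of_int \<rho> + 1 / 2 = (y + 1 / 2) - of_int \<rho>" by simp
  then have f1: "\<lfloor>y - of_int \<rho> + 1 / 2\<rfloor> = q - \<rho>"
    unfolding q_def quantize_def by (metis floor_diff_of_int)
  have "y - of_int \<rho> + 1 / 2 = (y + 1 / 2) - of_int \<rho>" by simp
  then have n1: "y - of_int \<rho> + 1 / 2 \<notin> \<int>" using assms(1) by (metis Ints_add Ints_of_int diff_add_cancel)
  have e: "y - of_int \<rho> - 1 / 2 = (y - of_int \<rho> + 1 / 2) - of_int 1" by simp
  then have f2: "\<lfloor>y - of_int \<rho> - 1 / 2\<rfloor> = q - \<rho> - 1" using f1 by (metis floor_diff_of_int)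
  have n2: "y - of_int \<rho> - 1 / 2 \<notin> \<int>" using n1 e by (metis Ints_add Ints_of_int diff_add_cancel)
  have N2: "(2::real) ^ k = of_int N" by (simp add: N_def)
  have "unit_box k (y - of_int \<rho>) = of_int ((q - \<rho>) div N - (q - \<rho> - 1) div N)"
    unfolding unit_box_def N2 ceil[OF nonint[OF n1]] ceil[OF nonint[OF n2]] floor_divide_real_eq_div[OF order.trans[OF zero_le_numeral N]] f1 f2
    by simp
  also have "(q - \<rho>) div N - (q - \<rho> - 1) div N = of_bool (N dvd q - \<rho>)"
  proof -
    define m where "m = q - \<rho> - 1"
    have "(m + 1) div N - m div N = of_bool (N dvd m + 1)"
    proof -
      let ?d = "m div N" and ?r = "m mod N"
      have m: "m = N * ?d + ?r" by simp
      have r: "0 \<le> ?r" "?r < N" using N by auto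
      show ?thesis
      proof (cases "?r + 1 = N")
        case True
        then have "m + 1 = N * (?d + 1)" using m unfolding distrib_left by linarith
        then show ?thesis using N by simp
      next
        case False
        have "(m + 1) div N = ?d" using m r False by (intro int_div_pos_eq[of _ _ _ "?r + 1"]) auto
        moreover have "(m + 1) mod N = ?r + 1" using m r False by (intro int_mod_pos_eq[of _ _ ?d]) auto
        ultimately show ?thesis using r by (simp add: dvd_eq_mod_eq_0)
      qed
    qed
    then show ?thesis by (simp add: m_def)
  qed
  finally show ?thesis by (simp add: q_def N_def mod_eq_dvd_iff)
qed

section \<open>Scaling and symmetries of \<open>A1\<close> and \<open>A2\<close>\<close>

lemma A1_rescale: "A1 \<sigma> \<epsilon> \<Delta> k c = A1 (\<sigma> * \<epsilon> / \<Delta>) 1 1 k c"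
  unfolding A1_def by (intro arg_cong2[where f = "(*)"] arg_cong2[where f = "(+)"] arg_cong[where f = suminf] refl ext)
    (simp add: field_simps)

lemma borel_measurable_A1 [measurable]: "A1 \<sigma> \<epsilon> \<Delta> k \<in> borel_measurable borel"
  unfolding A1_def[abs_def] by measurable

lemma A1_uminus: "A1 \<sigma> \<epsilon> \<Delta> k (- c) = A1 \<sigma> \<epsilon> \<Delta> k c"
  by (simp add: A1_def)

lemma A1_periodic: 
  assumes "k \<ge> 1"
  shows "A1 \<sigma> \<epsilon> \<Delta> k (c + 2 ^ k * of_int n) = A1 \<sigma> \<epsilon> \<Delta> k c"
proof -
  have "cos (pi * (c + 2 ^ k * of_int n) * real (Suc l) / 2 ^ (k - 1)) = cos (pi * c * real (Suc l) / 2 ^ (k - 1))" for l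
  proof -
    have "pi * (c + 2 ^ k * of_int n) * real (Suc l) / 2 ^ (k - 1)
        = pi * c * real (Suc l) / 2 ^ (k - 1) + of_int (n * int (Suc l)) * (2 * pi)"
      using power_eq_double[OF assms, where ?'a = real] by (simp add: field_simps)
    then show ?thesis
      using cos.plus_of_int[of "pi * c * real (Suc l) / 2 ^ (k - 1)" "n * int (Suc l)"]
      by (simp only: of_real_eq_id id_apply)
  qed
  then show ?thesis by (simp add: A1_def)
qed

text \<open>As \<open>A1\<close> is even with period \<open>2 ^ k\<close>, reflecting at a quarter
  period amounts to shifting by half a period. In this form \<open>A2\<close> is the weight of the
  residue that differs in bit \<open>k\<close> only.\<close>

lemma A2_eq: 
  assumes "k \<ge> 1"
  shows "A2 \<sigma> \<epsilon> \<Delta> k c = A1 \<sigma> \<epsilon> \<Delta> k (c + 2 ^ (k - 1))"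
proof -
  have "c + 2 ^ (k - 1) = - (2 ^ (k - 1) - c) + 2 ^ k * of_int 1"
    using power_eq_double[OF assms, where ?'a = real] by simp
  then show ?thesis unfolding A2_def by (metis A1_periodic[OF assms] A1_uminus)
qed

text \<open>Half a period to the left and to the right is the same point. With \<open>A1_abs\<close>
  this lets the distance \<open>c\<close> be exchanged for the signed offset.\<close>

lemma A2_abs:
  assumes "k \<ge> 1"
  shows "A2 \<sigma> \<epsilon> \<Delta> k \<bar>c\<bar> = A2 \<sigma> \<epsilon> \<Delta> k c"
proof -
  have "A2 \<sigma> \<epsilon> \<Delta> k (- c) = A2 \<sigma> \<epsilon> \<Delta> k c"
    using A2_eq[OF assms, of \<sigma> \<epsilon> \<Delta> c] by (simp add: A2_def add.commute)
  then show ?thesis by (simp add: abs_if)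
qed

lemma A1_abs: "A1 \<sigma> \<epsilon> \<Delta> k \<bar>c\<bar> = A1 \<sigma> \<epsilon> \<Delta> k c"
  by (simp add: abs_if A1_uminus)

lemma A1_add_multiple:
  assumes "k \<ge> 1"
  shows "A1 \<sigma> \<epsilon> \<Delta> k (c + 2 ^ (k - 1) * of_int t) = (if even t then A1 \<sigma> \<epsilon> \<Delta> k c else A2 \<sigma> \<epsilon> \<Delta> k c)"
proof (cases "even t")
  case True
  then obtain n where "t = 2 * n" by (elim evenE)
  then have "c + 2 ^ (k - 1) * of_int t = c + 2 ^ k * of_int n"
    using power_eq_double[OF assms, where ?'a = real] by simp
  then show ?thesis using True by (simp only: A1_periodic[OF assms] if_True)
next
  case False
  then obtain n where "t = 2 * n + 1" by (elim oddE)
  then have "c + 2 ^ (k - 1) * of_int t = (c + 2 ^ (k - 1)) + 2 ^ k * of_int n"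
    using power_eq_double[OF assms, where ?'a = real] by (simp add: algebra_simps)
  then show ?thesis using False by (simp only: A1_periodic[OF assms] A2_eq[OF assms] if_False)
qed

lemma borel_measurable_A2 [measurable]: "A2 \<sigma> \<epsilon> \<Delta> k \<in> borel_measurable borel"
  unfolding A2_def[abs_def] by measurable

section \<open>Error probability for a prediction independent of its error\<close>

text \<open>The single parameter \<open>s\<close> stands for
  \<open>\<sigma> * \<epsilon> / \<Delta>\<close>, the only combination of the three on which
  \<open>A1\<close> depends by \<open>A1_rescale\<close>.\<close>

definition likelihood :: "real \<Rightarrow> nat \<Rightarrow> real \<Rightarrow> real" where
  "likelihood s k c = A2 s 1 1 k c / (A1 s 1 1 k c + A2 s 1 1 k c)"

lemma borel_measurable_likelihood [measurable]: "likelihood s k \<in> borel_measurable borel"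
  unfolding likelihood_def[abs_def] by measurable

text \<open>Rounds \<open>z / 2 ^ (k - 1)\<close> to the nearest integer, ties upwards. At
  \<open>z = yhat - q\<close> it counts the steps of length \<open>2 ^ (k - 1)\<close> from
  \<open>q\<close> to the nearest consistent integer; its parity decides whether the predicted bit
  is wrong, and \<open>centered_rem\<close> is the signed offset.\<close>

definition step_index :: "nat \<Rightarrow> real \<Rightarrow> int" where
  "step_index k z = \<lfloor>z / 2 ^ (k - 1) + 1 / 2\<rfloor>"

definition centered_rem :: "nat \<Rightarrow> real \<Rightarrow> real" where
  "centered_rem k z = z - 2 ^ (k - 1) * of_int (step_index k z)"

lemma step_index_add: "step_index k (z + 2 ^ (k - 1) * of_int n) = step_index k z + n"
proof -
  have "(z + 2 ^ (k - 1) * of_int n) / 2 ^ (k - 1) + 1 / 2 = (z / 2 ^ (k - 1) + 1 / 2) + of_int n"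
    by (simp add: field_simps)
  then show ?thesis unfolding step_index_def by (simp only: floor_add_int)
qed

lemma centered_rem_add: "centered_rem k (z + 2 ^ (k - 1) * of_int n) = centered_rem k z"
  unfolding centered_rem_def step_index_add by (simp add: algebra_simps)

lemma measurable_step_index [measurable]: "step_index k \<in> measurable borel (count_space UNIV)"
  unfolding step_index_def[abs_def] by measurable

lemma borel_measurable_centered_rem [measurable]: "centered_rem k \<in> borel_measurable borel"
  unfolding centered_rem_def[abs_def] by measurable

lemma measurable_quantize [measurable]: "quantize \<in> measurable borel (count_space UNIV)"
  unfolding quantize_def[abs_def] by measurable

text \<open>The assumptions \<open>cos_D\<close> and \<open>sin_D\<close> state that \<open>D\<close> is independent of \<open>U\<close> with the characteristic
  function of a centered normal variable of standard deviation \<open>s\<close>; \<open>s = 0\<close> is allowed.\<close>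

locale noise_prediction = prob_space M for M :: "'w measure" +
  fixes U D :: "'w \<Rightarrow> real" and s :: real and k :: nat
  assumes k: "k \<ge> 1"
    and U [measurable]: "random_variable borel U"
    and D [measurable]: "random_variable borel D"
    and cos_D: "\<And>\<psi> t. \<psi> \<in> borel_measurable borel \<Longrightarrow> (\<And>u. \<bar>\<psi> u\<bar> \<le> 1) \<Longrightarrow>
      expectation (\<lambda>\<omega>. \<psi> (U \<omega>) * cos (t * D \<omega>)) = expectation (\<lambda>\<omega>. \<psi> (U \<omega>)) * exp (- (1 / 2) * (s * t)\<^sup>2)"
    and sin_D: "\<And>\<psi> t. \<psi> \<in> borel_measurable borel \<Longrightarrow> (\<And>u. \<bar>\<psi> u\<bar> \<le> 1) \<Longrightarrow>
      expectation (\<lambda>\<omega>. \<psi> (U \<omega>) * sin (t * D \<omega>)) = 0"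
    and no_tie: "AE \<omega> in M. U \<omega> + D \<omega> + 1 / 2 \<notin> \<int>"
begin

section \<open>Averaging the Fourier series over the prediction error\<close>

lemma integrable_bounded:
  fixes f :: "'w \<Rightarrow> real"
  assumes "f \<in> borel_measurable M" "\<And>\<omega>. \<bar>f \<omega>\<bar> \<le> B"
  shows "integrable M f"
  using assms by (intro integrable_const_bound[of _ B]) auto

text \<open>The partial sums of \<open>A1 s 1 1 k\<close>, with the exponential arranged as the
  characteristic function of \<open>D\<close> at the frequency of the cosine next to it.\<close>

definition A1_sum :: "nat \<Rightarrow> real \<Rightarrow> real" where
  "A1_sum L z = 1 / 2 ^ k * (1 + 2 * (\<Sum>l<L. exp (- (1/2) * (s * (pi * real (Suc l) / 2 ^ (k - 1)))\<^sup>2)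
    * cos (pi * z * real (Suc l) / 2 ^ (k - 1)) * normalized_sinc (real (Suc l) / 2 ^ k)))"

lemma borel_measurable_A1_sum [measurable]: "A1_sum L \<in> borel_measurable borel"
  unfolding A1_sum_def[abs_def] by measurable

lemma borel_measurable_unit_box_sum [measurable]: "unit_box_sum k L \<in> borel_measurable borel"
  unfolding unit_box_sum_def[abs_def] by measurable

lemma borel_measurable_unit_box [measurable]: "unit_box k \<in> borel_measurable borel"
  unfolding unit_box_def[abs_def] by measurable

text \<open>Each cosine of \<open>g (U) + D\<close> is expanded by the addition theorem. With
  \<open>\<psi>\<close> times a cosine or sine of \<open>g (U)\<close> as the test function, still
  bounded by 1, \<open>cos_D\<close> supplies the exponential factor and \<open>sin_D\<close>
  removes the other product.\<close>

lemma expectation_unit_box_sum: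
  assumes [measurable]: "\<psi> \<in> borel_measurable borel" "g \<in> borel_measurable borel" and \<psi>: "\<And>u. \<bar>\<psi> u\<bar> \<le> 1"
  shows "expectation (\<lambda>\<omega>. \<psi> (U \<omega>) * unit_box_sum k L (g (U \<omega>) + D \<omega>)) = expectation (\<lambda>\<omega>. \<psi> (U \<omega>) * A1_sum L (g (U \<omega>)))"
proof -
  define a where "a l = pi * real (Suc l) / 2 ^ (k - 1)" for l :: nat
  define e where "e l = exp (- (1/2) * (s * a l)\<^sup>2)" for l
  define n where "n l = normalized_sinc (real (Suc l) / 2 ^ k)" for l
  have b1: "\<bar>\<psi> u * cos x\<bar> \<le> 1" "\<bar>\<psi> u * sin x\<bar> \<le> 1" for u x
    unfolding abs_mult using \<psi>[of u] abs_cos_le_one[of x] abs_sin_le_one[of x]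
    by (auto intro: mult_le_one simp del: abs_cos_le_one abs_sin_le_one)
  have b2: "\<bar>\<psi> u * cos x * cos y\<bar> \<le> 1" "\<bar>\<psi> u * sin x * sin y\<bar> \<le> 1" for u x y
    using b1[of u x] abs_cos_le_one[of y] abs_sin_le_one[of y]
    by (auto intro: mult_le_one simp: abs_mult simp del: abs_cos_le_one abs_sin_le_one)
  have int: "integrable M (\<lambda>\<omega>. \<psi> (U \<omega>) * cos (x * g (U \<omega>)) * cos (y * D \<omega>))"
      "integrable M (\<lambda>\<omega>. \<psi> (U \<omega>) * sin (x * g (U \<omega>)) * sin (y * D \<omega>))"
      "integrable M (\<lambda>\<omega>. \<psi> (U \<omega>) * cos (x * g (U \<omega>)))" "integrable M (\<lambda>\<omega>. \<psi> (U \<omega>))"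
      "integrable M (\<lambda>\<omega>. \<psi> (U \<omega>) * cos (x * (g (U \<omega>) + D \<omega>)))" for x y
    using b1 b2 \<psi> by (auto intro!: integrable_bounded[where B = 1])
  have key: "expectation (\<lambda>\<omega>. \<psi> (U \<omega>) * cos (x * (g (U \<omega>) + D \<omega>)))
      = expectation (\<lambda>\<omega>. \<psi> (U \<omega>) * cos (x * g (U \<omega>))) * exp (- (1/2) * (s * x)\<^sup>2)" for x
  proof -
    have "(\<lambda>\<omega>. \<psi> (U \<omega>) * cos (x * (g (U \<omega>) + D \<omega>)))
      = (\<lambda>\<omega>. \<psi> (U \<omega>) * cos (x * g (U \<omega>)) * cos (x * D \<omega>) - \<psi> (U \<omega>) * sin (x * g (U \<omega>)) * sin (x * D \<omega>))"
      by (simp add: cos_add algebra_simps)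
    moreover have "expectation (\<lambda>\<omega>. \<psi> (U \<omega>) * cos (x * g (U \<omega>)) * cos (x * D \<omega>))
       = expectation (\<lambda>\<omega>. \<psi> (U \<omega>) * cos (x * g (U \<omega>))) * exp (- (1/2) * (s * x)\<^sup>2)"
      using cos_D[of "\<lambda>u. \<psi> u * cos (x * g u)" x] b1 by simp
    moreover have "expectation (\<lambda>\<omega>. \<psi> (U \<omega>) * sin (x * g (U \<omega>)) * sin (x * D \<omega>)) = 0"
      using sin_D[of "\<lambda>u. \<psi> u * sin (x * g u)" x] b1 by simp
    ultimately show ?thesis using int by simp
  qed
  have "(\<lambda>\<omega>. \<psi> (U \<omega>) * unit_box_sum k L (g (U \<omega>) + D \<omega>))
    = (\<lambda>\<omega>. 1 / 2 ^ k * (\<psi> (U \<omega>) + 2 * (\<Sum>l<L. (\<psi> (U \<omega>) * cos (a l * (g (U \<omega>) + D \<omega>))) * n l)))"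
    unfolding unit_box_sum_def a_def n_def by (simp add: sum_distrib_left algebra_simps)
  moreover have "(\<lambda>\<omega>. \<psi> (U \<omega>) * A1_sum L (g (U \<omega>)))
    = (\<lambda>\<omega>. 1 / 2 ^ k * (\<psi> (U \<omega>) + 2 * (\<Sum>l<L. (\<psi> (U \<omega>) * cos (a l * g (U \<omega>)) * e l) * n l)))"
    unfolding A1_sum_def a_def n_def e_def by (simp add: sum_distrib_left algebra_simps)
  moreover have "expectation (\<lambda>\<omega>. 1 / 2 ^ k * (\<psi> (U \<omega>) + 2 * (\<Sum>l<L. (\<psi> (U \<omega>) * cos (a l * (g (U \<omega>) + D \<omega>))) * n l)))
    = 1 / 2 ^ k * (expectation (\<lambda>\<omega>. \<psi> (U \<omega>)) + 2 * (\<Sum>l<L. expectation (\<lambda>\<omega>. \<psi> (U \<omega>) * cos (a l * (g (U \<omega>) + D \<omega>))) * n l))"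
    using int by simp
  moreover have "expectation (\<lambda>\<omega>. 1 / 2 ^ k * (\<psi> (U \<omega>) + 2 * (\<Sum>l<L. (\<psi> (U \<omega>) * cos (a l * g (U \<omega>)) * e l) * n l)))
    = 1 / 2 ^ k * (expectation (\<lambda>\<omega>. \<psi> (U \<omega>)) + 2 * (\<Sum>l<L. expectation (\<lambda>\<omega>. \<psi> (U \<omega>) * cos (a l * g (U \<omega>))) * e l * n l))"
    using int by simp
  ultimately show ?thesis unfolding key e_def by simp
qed

text \<open>The case of constant \<open>\<psi>\<close> and \<open>g\<close>, through which the sums
  inherit the uniform bound and the convergence of the box sums.\<close>

lemma A1_sum_eq_expectation: "A1_sum L z = expectation (\<lambda>\<omega>. unit_box_sum k L (z + D \<omega>))"
  using expectation_unit_box_sum[of "\<lambda>_. 1" "\<lambda>_. z" L] by (simp add: prob_space)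

lemma abs_A1_sum_le: "\<bar>A1_sum L z\<bar> \<le> 41"
proof -
  have "integrable M (\<lambda>\<omega>. unit_box_sum k L (z + D \<omega>))"
    using abs_unit_box_sum_le[OF k] by (intro integrable_bounded[where B = 41]) auto
  then show ?thesis unfolding A1_sum_eq_expectation abs_le_iff
    using abs_unit_box_sum_le[OF k, unfolded abs_le_iff]
    by (auto intro!: integral_le_const simp: integral_minus[symmetric] simp del: integral_minus)
qed

lemma A1_sum_tendsto_expectation: "(\<lambda>L. A1_sum L z) \<longlonglongrightarrow> expectation (\<lambda>\<omega>. unit_box k (z + D \<omega>))"
  unfolding A1_sum_eq_expectation
  by (rule integral_dominated_convergence[where w = "\<lambda>_. 41"])
    (auto simp: abs_unit_box_sum_le[OF k] intro: unit_box_sum_tendsto[OF k])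

text \<open>The value of \<open>suminf\<close> is meaningful only for a convergent series.
  Convergence is read off from the limit of the averaged box sums, so no decay of the exponential
  enters and \<open>s = 0\<close> is included.\<close>

lemma A1_sum_tendsto: "(\<lambda>L. A1_sum L z) \<longlonglongrightarrow> A1 s 1 1 k z"
proof -
  define f where "f l = exp (- (1/2) * (s * (pi * real (Suc l) / 2 ^ (k - 1)))\<^sup>2)
    * cos (pi * z * real (Suc l) / 2 ^ (k - 1)) * normalized_sinc (real (Suc l) / 2 ^ k)" for l
  have S: "A1_sum L z = 1 / 2 ^ k * (1 + 2 * (\<Sum>l<L. f l))" for L by (simp add: A1_sum_def f_def)
  then have "(\<Sum>l<L. f l) = (2 ^ k * A1_sum L z - 1) / 2" for L by (simp add: field_simps)
  moreover have "(\<lambda>L. (2 ^ k * A1_sum L z - 1) / 2) \<longlonglongrightarrow> (2 ^ k * expectation (\<lambda>\<omega>. unit_box k (z + D \<omega>)) - 1) / 2"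
    by (intro tendsto_intros A1_sum_tendsto_expectation) auto
  ultimately have "f sums ((2 ^ k * expectation (\<lambda>\<omega>. unit_box k (z + D \<omega>)) - 1) / 2)"
    unfolding sums_def by (simp only:)
  then have "summable f" by (rule sums_summable)
  then have "(\<lambda>L. \<Sum>l<L. f l) \<longlonglongrightarrow> suminf f" by (rule summable_LIMSEQ)
  then have "(\<lambda>L. A1_sum L z) \<longlonglongrightarrow> 1 / 2 ^ k * (1 + 2 * suminf f)"
    unfolding S by (intro tendsto_intros)
  also have "1 / 2 ^ k * (1 + 2 * suminf f) = A1 s 1 1 k z"
    by (simp add: A1_def f_def[abs_def] mult_ac)
  finally show ?thesis .
qed

text \<open>Not visible from the series; it holds because \<open>A1\<close> is an average of the
  nonnegative \<open>unit_box\<close>.\<close>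

lemma A1_nonneg: "A1 s 1 1 k z \<ge> 0"
proof -
  have "A1 s 1 1 k z = expectation (\<lambda>\<omega>. unit_box k (z + D \<omega>))"
    by (rule LIMSEQ_unique[OF A1_sum_tendsto A1_sum_tendsto_expectation])
  then show ?thesis by (simp add: unit_box_nonneg)
qed

lemma A2_nonneg: "A2 s 1 1 k z \<ge> 0"
  unfolding A2_def by (rule A1_nonneg)

lemma abs_A1_le: "\<bar>A1 s 1 1 k z\<bar> \<le> 41"
  by (rule LIMSEQ_le_const2[OF tendsto_rabs[OF A1_sum_tendsto]]) (auto intro: abs_A1_sum_le)

text \<open>The conditional law of the residue given \<open>U\<close>, in weak form. Both sides are
  limits of one sequence: the box sums tend to the indicator outside the null set of ties, and
  averaging over \<open>D\<close> turns them into \<open>A1_sum\<close>.\<close>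

lemma expectation_quantize_eq:
  assumes [measurable]: "\<psi> \<in> borel_measurable borel" and \<psi>: "\<And>u. \<bar>\<psi> u\<bar> \<le> 1"
  shows "expectation (\<lambda>\<omega>. \<psi> (U \<omega>) * of_bool (quantize (U \<omega> + D \<omega>) mod 2 ^ k = \<rho> mod 2 ^ k))
    = expectation (\<lambda>\<omega>. \<psi> (U \<omega>) * A1 s 1 1 k (U \<omega> - of_int \<rho>))"
proof (rule LIMSEQ_unique)
  have b: "\<bar>\<psi> u * x\<bar> \<le> 41" if "\<bar>x\<bar> \<le> 41" for u x
    using mult_mono[OF \<psi>[of u] that] by (simp add: abs_mult)
  have "(\<lambda>L. expectation (\<lambda>\<omega>. \<psi> (U \<omega>) * unit_box_sum k L (U \<omega> - of_int \<rho> + D \<omega>)))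
     \<longlonglongrightarrow> expectation (\<lambda>\<omega>. \<psi> (U \<omega>) * unit_box k (U \<omega> - of_int \<rho> + D \<omega>))"
    by (rule integral_dominated_convergence[where w = "\<lambda>_. 41"])
      (auto intro!: b abs_unit_box_sum_le[OF k] tendsto_mult unit_box_sum_tendsto[OF k])
  also have "expectation (\<lambda>\<omega>. \<psi> (U \<omega>) * unit_box k (U \<omega> - of_int \<rho> + D \<omega>))
    = expectation (\<lambda>\<omega>. \<psi> (U \<omega>) * of_bool (quantize (U \<omega> + D \<omega>) mod 2 ^ k = \<rho> mod 2 ^ k))"
  proof (rule integral_cong_AE)
    show "AE \<omega> in M. \<psi> (U \<omega>) * unit_box k (U \<omega> - of_int \<rho> + D \<omega>)
      = \<psi> (U \<omega>) * of_bool (quantize (U \<omega> + D \<omega>) mod 2 ^ k = \<rho> mod 2 ^ k)"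
      using no_tie
    proof eventually_elim
      case (elim \<omega>)
      then show ?case using unit_box_eq_indicator[OF elim k, of \<rho>] by (simp add: algebra_simps)
    qed
  qed (auto simp: of_bool_def)
  finally show "(\<lambda>L. expectation (\<lambda>\<omega>. \<psi> (U \<omega>) * unit_box_sum k L (U \<omega> - of_int \<rho> + D \<omega>)))
     \<longlonglongrightarrow> expectation (\<lambda>\<omega>. \<psi> (U \<omega>) * of_bool (quantize (U \<omega> + D \<omega>) mod 2 ^ k = \<rho> mod 2 ^ k))" .
  have "expectation (\<lambda>\<omega>. \<psi> (U \<omega>) * unit_box_sum k L (U \<omega> - of_int \<rho> + D \<omega>))
    = expectation (\<lambda>\<omega>. \<psi> (U \<omega>) * A1_sum L (U \<omega> - of_int \<rho>))" for L
    by (rule expectation_unit_box_sum[of \<psi> "\<lambda>u. u - of_int \<rho>"]) (auto intro: \<psi>)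
  then show "(\<lambda>L. expectation (\<lambda>\<omega>. \<psi> (U \<omega>) * unit_box_sum k L (U \<omega> - of_int \<rho> + D \<omega>)))
     \<longlonglongrightarrow> expectation (\<lambda>\<omega>. \<psi> (U \<omega>) * A1 s 1 1 k (U \<omega> - of_int \<rho>))"
    by (auto intro!: integral_dominated_convergence[where w = "\<lambda>_. 41"] b abs_A1_sum_le tendsto_mult A1_sum_tendsto)
qed

section \<open>Bayes' rule on pairs of residues\<close>

lemma likelihood_bounds: "0 \<le> likelihood s k c" "likelihood s k c \<le> 1"
  using A1_nonneg[of c] A2_nonneg[of c] unfolding likelihood_def
  by (auto intro!: divide_nonneg_nonneg divide_le_eq_1[THEN iffD2])

text \<open>If the sum of the weights is 0, both vanish by nonnegativity, and the default value of
  the division does no harm.\<close>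

lemma likelihood_mult: "likelihood s k c * (A1 s 1 1 k c + A2 s 1 1 k c) = A2 s 1 1 k c"
  using A1_nonneg[of c] A2_nonneg[of c] unfolding likelihood_def
  by (cases "A1 s 1 1 k c + A2 s 1 1 k c = 0") auto

text \<open>Both points have the same centered remainder \<open>c\<close> and step indices of
  opposite parity; the odd one carries weight \<open>A2 c\<close>, the even one \<open>A1 c\<close>.
  The sum is therefore \<open>A2 c\<close> minus the likelihood times the total weight.\<close>

lemma likelihood_pair:
  assumes z: "z' = z - 2 ^ (k - 1)"
  shows "(of_bool (odd (step_index k z)) - likelihood s k (centered_rem k z)) * A1 s 1 1 k z
    + (of_bool (odd (step_index k z')) - likelihood s k (centered_rem k z')) * A1 s 1 1 k z' = 0"
proof -
  define c where "c = centered_rem k z"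
  define t where "t = step_index k z"
  have "z' = z + 2 ^ (k - 1) * of_int (- 1)" using z by simp
  then have t': "step_index k z' = t - 1" and c': "centered_rem k z' = c"
    unfolding t_def c_def by (simp_all only: step_index_add centered_rem_add)
  have z1: "z = c + 2 ^ (k - 1) * of_int t" by (simp add: c_def t_def centered_rem_def)
  then have z2: "z' = c + 2 ^ (k - 1) * of_int (t - 1)" using z by (simp add: algebra_simps)
  have "A1 s 1 1 k z = (if even t then A1 s 1 1 k c else A2 s 1 1 k c)"
    unfolding z1 by (rule A1_add_multiple[OF k])
  moreover have "A1 s 1 1 k z' = (if even t then A2 s 1 1 k c else A1 s 1 1 k c)"
    unfolding z2 A1_add_multiple[OF k] by simp
  ultimately show ?thesis
    using likelihood_mult[of c] unfolding t' c' c_def[symmetric] t_def[symmetric] by (auto simp: algebra_simps)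
qed

text \<open>The integrand is split over the residues of \<open>Q\<close> modulo
  \<open>2 ^ k\<close>, \<open>expectation_quantize_eq\<close> replaces each residue indicator by
  its weight, and residues sharing the known bits cancel by \<open>likelihood_pair\<close>. The set
  \<open>S\<close> may vary with the residue modulo \<open>2 ^ (k - 1)\<close>, which is what the
  known bits reveal.\<close>

lemma expectation_error_minus_likelihood:
  fixes S :: "int \<Rightarrow> real set"
  assumes S [measurable]: "\<And>\<rho>. S \<rho> \<in> sets borel"
  defines "Q \<equiv> \<lambda>\<omega>. quantize (U \<omega> + D \<omega>)"
  shows "expectation (\<lambda>\<omega>. of_bool (U \<omega> \<in> S (Q \<omega> mod 2 ^ (k - 1)))
    * (of_bool (odd (step_index k (U \<omega> - of_int (Q \<omega>)))) - likelihood s k (centered_rem k (U \<omega> - of_int (Q \<omega>))))) = 0"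
proof -
  define P :: int where "P = 2 ^ (k - 1)"
  define N :: int where "N = 2 ^ k"
  have N: "N = 2 * P" "P > 0" "N > 0" using power_eq_double[OF k, where ?'a = int] by (simp_all add: N_def P_def)
  have [measurable]: "Q \<in> measurable M (count_space UNIV)" unfolding Q_def by measurable
  define F where "F u \<rho> = of_bool (u \<in> S (\<rho> mod P))
    * (of_bool (odd (step_index k (u - of_int \<rho>))) - likelihood s k (centered_rem k (u - of_int \<rho>)))" for u \<rho>
  \<comment> \<open>A multiple of \<open>N\<close> is an even number of steps \<open>P\<close>, so
    parity, remainder and known residue are all unchanged.\<close>
  have F_mod: "F u (\<rho> mod N) = F u \<rho>" for u \<rho>
  proof -
    have "\<rho> mod N = \<rho> - N * (\<rho> div N)" by (simp add: minus_mult_div_eq_mod)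
    then have e: "u - of_int (\<rho> mod N) = (u - of_int \<rho>) + 2 ^ (k - 1) * of_int (2 * (\<rho> div N))"
      unfolding N(1) P_def by simp
    have "\<rho> mod N mod P = \<rho> mod P" unfolding N(1) by (simp add: mod_mod_cancel)
    then show ?thesis unfolding F_def e step_index_add centered_rem_add by simp
  qed
  have F_meas [measurable]: "(\<lambda>u. F u \<rho>) \<in> borel_measurable borel" for \<rho>
    unfolding F_def of_bool_def by measurable
  have F_bound: "\<bar>F u \<rho>\<bar> \<le> 1" for u \<rho>
    using likelihood_bounds[of "centered_rem k (u - of_int \<rho>)"] by (auto simp: F_def)
  have zero: "(\<Sum>\<rho>\<in>{0..<N}. F u \<rho> * A1 s 1 1 k (u - of_int \<rho>)) = 0" for u
  proof -
    \<comment> \<open>Pairs each \<open>\<rho>\<close> below \<open>P\<close> with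
      \<open>\<rho> + P\<close>, the residue having the same known bits and the opposite bit
      \<open>k\<close>.\<close>
    have "{0..<N} = {0..<P} \<union> (\<lambda>\<rho>. \<rho> + P) ` {0..<P}" using N by (auto simp: image_iff)
    moreover have "{0..<P} \<inter> (\<lambda>\<rho>. \<rho> + P) ` {0..<P} = {}" by auto
    ultimately have "(\<Sum>\<rho>\<in>{0..<N}. F u \<rho> * A1 s 1 1 k (u - of_int \<rho>))
      = (\<Sum>\<rho>\<in>{0..<P}. F u \<rho> * A1 s 1 1 k (u - of_int \<rho>)) + (\<Sum>\<rho>\<in>(\<lambda>\<rho>. \<rho> + P) ` {0..<P}. F u \<rho> * A1 s 1 1 k (u - of_int \<rho>))"
      by (simp add: sum.union_disjoint)
    also have "\<dots> = (\<Sum>\<rho>\<in>{0..<P}. F u \<rho> * A1 s 1 1 k (u - of_int \<rho>) + F u (\<rho> + P) * A1 s 1 1 k (u - of_int (\<rho> + P)))"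
      by (subst sum.reindex) (auto simp: sum.distrib inj_on_def)
    also have "\<dots> = 0"
    proof (intro sum.neutral ballI)
      fix \<rho> assume "\<rho> \<in> {0..<P}"
      have "u - of_int (\<rho> + P) = u - of_int \<rho> - 2 ^ (k - 1)" by (simp add: P_def)
      note likelihood_pair[OF this]
      moreover have "(\<rho> + P) mod P = \<rho> mod P" by simp
      ultimately show "F u \<rho> * A1 s 1 1 k (u - of_int \<rho>) + F u (\<rho> + P) * A1 s 1 1 k (u - of_int (\<rho> + P)) = 0"
        unfolding F_def by (simp add: mult.assoc flip: distrib_left)
    qed
    finally show ?thesis .
  qed
  \<comment> \<open>Exactly one summand survives, the one at
    \<open>Q \<omega> mod N\<close>.\<close>
  have "F (U \<omega>) (Q \<omega>) = (\<Sum>\<rho>\<in>{0..<N}. F (U \<omega>) \<rho> * of_bool (Q \<omega> mod N = \<rho> mod N))" for \<omega>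
  proof -
    have "(\<Sum>\<rho>\<in>{0..<N}. F (U \<omega>) \<rho> * of_bool (Q \<omega> mod N = \<rho> mod N)) = (\<Sum>\<rho>\<in>{Q \<omega> mod N}. F (U \<omega>) \<rho> * of_bool (Q \<omega> mod N = \<rho> mod N))"
      by (rule sum.mono_neutral_right) (use N in auto)
    then show ?thesis by (simp add: F_mod)
  qed
  then have "expectation (\<lambda>\<omega>. F (U \<omega>) (Q \<omega>)) = expectation (\<lambda>\<omega>. \<Sum>\<rho>\<in>{0..<N}. F (U \<omega>) \<rho> * of_bool (Q \<omega> mod N = \<rho> mod N))"
    by simp
  also have "\<dots> = (\<Sum>\<rho>\<in>{0..<N}. expectation (\<lambda>\<omega>. F (U \<omega>) \<rho> * of_bool (Q \<omega> mod N = \<rho> mod N)))"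
    using F_bound by (intro Bochner_Integration.integral_sum integrable_bounded[where B = 1]) (auto simp: of_bool_def)
  also have "\<dots> = (\<Sum>\<rho>\<in>{0..<N}. expectation (\<lambda>\<omega>. F (U \<omega>) \<rho> * A1 s 1 1 k (U \<omega> - of_int \<rho>)))"
    unfolding Q_def N_def by (intro sum.cong refl expectation_quantize_eq F_meas F_bound)
  also have "\<dots> = expectation (\<lambda>\<omega>. \<Sum>\<rho>\<in>{0..<N}. F (U \<omega>) \<rho> * A1 s 1 1 k (U \<omega> - of_int \<rho>))"
    using mult_mono[OF F_bound abs_A1_le]
    by (intro Bochner_Integration.integral_sum[symmetric] integrable_bounded[where B = 41]) (auto simp: abs_mult)
  also have "\<dots> = 0" by (simp add: zero)
  finally show ?thesis by (simp add: F_def P_def)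
qed

end

section \<open>Bits and nearest consistent integers\<close>

text \<open>Bit \<open>i\<close> here is \<open>bit\<close> number \<open>i - 1\<close>, and
  agreement of the lowest \<open>k - 1\<close> of them is equality of
  \<open>take_bit (k - 1)\<close>, a residue also for negative integers.\<close>

lemma consistent_kth_bit_iff:
  "consistent k (\<lambda>i. kth_bit i q) j \<longleftrightarrow> 2 ^ (k - 1) dvd j - q"
proof -
  have "consistent k (\<lambda>i. kth_bit i q) j \<longleftrightarrow> (\<forall>n<k - 1. bit j n = bit q n)"
  proof
    assume c: "consistent k (\<lambda>i. kth_bit i q) j"
    show "\<forall>n<k - 1. bit j n = bit q n"
    proof (intro allI impI)
      fix n assume "n < k - 1"
      then have "kth_bit (Suc n) j = kth_bit (Suc n) q" using c by (auto simp: consistent_def)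
      then show "bit j n = bit q n" by (simp add: kth_bit_def bit_iff_odd odd_iff_mod_2_eq_one)
    qed
  next
    assume b: "\<forall>n<k - 1. bit j n = bit q n"
    show "consistent k (\<lambda>i. kth_bit i q) j" unfolding consistent_def
    proof
      fix i assume "i \<in> {1..<k}"
      then have "bit j (i - 1) = bit q (i - 1)" using b by auto
      then show "kth_bit i j = kth_bit i q" by (auto simp: kth_bit_def bit_iff_odd mod_2_eq_odd)
    qed
  qed
  also have "\<dots> \<longleftrightarrow> take_bit (k - 1) j = take_bit (k - 1) q"
    by (auto simp: bit_eq_iff bit_take_bit_iff)
  also have "\<dots> \<longleftrightarrow> 2 ^ (k - 1) dvd j - q" by (simp add: take_bit_eq_mod mod_eq_dvd_iff)
  finally show ?thesis .
qed

lemma kth_bit_add_neq_iff: "kth_bit k (q + 2 ^ (k - 1) * t) \<noteq> kth_bit k q \<longleftrightarrow> odd t"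
  by (auto simp: kth_bit_def mod_2_eq_odd)

text \<open>After division by \<open>2 ^ (k - 1)\<close> this is rounding to the nearest integer.
  Another integer is equally near only at the lower end of the rounding interval, which the second
  part excludes.\<close>

lemma abs_diff_step_index_le:
  "\<bar>z - 2 ^ (k - 1) * of_int (step_index k z)\<bar> \<le> \<bar>z - 2 ^ (k - 1) * of_int t\<bar>"
  "t \<noteq> step_index k z \<Longrightarrow> z / 2 ^ (k - 1) + 1 / 2 \<notin> \<int> \<Longrightarrow>
    \<bar>z - 2 ^ (k - 1) * of_int (step_index k z)\<bar> < \<bar>z - 2 ^ (k - 1) * of_int t\<bar>"
proof -
  define P :: real where "P = 2 ^ (k - 1)"
  have P: "P > 0" by (simp add: P_def)
  define x where "x = z / P"
  define n where "n = step_index k z"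
  have n: "of_int n \<le> x + 1 / 2" "x + 1 / 2 < of_int n + 1"
    unfolding n_def step_index_def x_def P_def by linarith+
  have scale: "\<bar>z - P * y\<bar> = P * \<bar>x - y\<bar>" for y
  proof -
    have "z - P * y = P * (x - y)" using P by (simp add: x_def right_diff_distrib)
    then show ?thesis using P by (simp add: abs_mult)
  qed
  have "t = n \<or> t \<ge> n + 1 \<or> t \<le> n - 1" by linarith
  then have "of_int t = (of_int n :: real) \<or> (of_int t :: real) \<ge> of_int n + 1 \<or> (of_int t :: real) \<le> of_int n - 1"
    by (metis of_int_1 of_int_add of_int_diff of_int_le_iff)
  then have "\<bar>x - of_int n\<bar> \<le> \<bar>x - of_int t\<bar>" using n by linarith
  then show "\<bar>z - 2 ^ (k - 1) * of_int (step_index k z)\<bar> \<le> \<bar>z - 2 ^ (k - 1) * of_int t\<bar>"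
    unfolding P_def[symmetric] n_def[symmetric] scale using P by (intro mult_left_mono) auto
  assume t: "t \<noteq> step_index k z" and tie: "z / 2 ^ (k - 1) + 1 / 2 \<notin> \<int>"
  then have "of_int n \<noteq> x + 1 / 2" unfolding x_def P_def by (metis Ints_of_int)
  with n have n': "of_int n < x + 1 / 2" by linarith
  have "t \<ge> n + 1 \<or> t \<le> n - 1" using t by (simp add: n_def) linarith
  then have "(of_int t :: real) \<ge> of_int n + 1 \<or> (of_int t :: real) \<le> of_int n - 1"
    by (metis of_int_1 of_int_add of_int_diff of_int_le_iff)
  then have "\<bar>x - of_int n\<bar> < \<bar>x - of_int t\<bar>" using n n' by linarith
  then show "\<bar>z - 2 ^ (k - 1) * of_int (step_index k z)\<bar> < \<bar>z - 2 ^ (k - 1) * of_int t\<bar>"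
    unfolding P_def[symmetric] n_def[symmetric] scale using P by (intro mult_strict_left_mono) auto
qed

text \<open>An explicit minimizer for the \<open>ARG_MIN\<close> in
  \<open>closest_consistent\<close>, with ties resolved upwards.\<close>

definition nearest :: "nat \<Rightarrow> real \<Rightarrow> int \<Rightarrow> int" where
  "nearest k u q = q + 2 ^ (k - 1) * step_index k (u - of_int q)"

lemma diff_nearest: "u - of_int (nearest k u q) = centered_rem k (u - of_int q)"
  by (simp add: nearest_def centered_rem_def)

lemma consistent_nearest: "consistent k (\<lambda>i. kth_bit i q) (nearest k u q)"
  by (simp add: consistent_kth_bit_iff nearest_def)

text \<open>At a tie \<open>u\<close> lies midway between two integers, so \<open>2 * u\<close> is
  integral. This exclusion is independent of \<open>k\<close> and \<open>q\<close> and concerns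
  countably many \<open>u\<close>.\<close>

lemma nearest_le:
  assumes "consistent k (\<lambda>i. kth_bit i q) j"
  shows "\<bar>u - of_int (nearest k u q)\<bar> \<le> \<bar>u - of_int j\<bar>"
    and "j \<noteq> nearest k u q \<Longrightarrow> 2 * u \<notin> \<int> \<Longrightarrow> \<bar>u - of_int (nearest k u q)\<bar> < \<bar>u - of_int j\<bar>"
proof -
  obtain t where "j - q = 2 ^ (k - 1) * t" using assms unfolding consistent_kth_bit_iff by (elim dvdE)
  then have j: "j = q + 2 ^ (k - 1) * t" by simp
  have d: "u - of_int (q + 2 ^ (k - 1) * t) = (u - of_int q) - 2 ^ (k - 1) * of_int t" for t by simp
  show "\<bar>u - of_int (nearest k u q)\<bar> \<le> \<bar>u - of_int j\<bar>"
    unfolding j nearest_def d by (rule abs_diff_step_index_le)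
  assume ne: "j \<noteq> nearest k u q" and tie: "2 * u \<notin> \<int>"
  have "(u - of_int q) / 2 ^ (k - 1) + 1 / 2 \<notin> \<int>"
  proof
    assume "(u - of_int q) / 2 ^ (k - 1) + 1 / 2 \<in> \<int>"
    then obtain m where "(u - of_int q) / 2 ^ (k - 1) + 1 / 2 = of_int m" by (elim Ints_cases)
    then have "2 * u = of_int (2 * q + 2 ^ (k - 1) * (2 * m - 1))" by (simp add: field_simps)
    then show False using tie by (metis Ints_of_int)
  qed
  then show "\<bar>u - of_int (nearest k u q)\<bar> < \<bar>u - of_int j\<bar>"
    unfolding j nearest_def d using ne by (intro abs_diff_step_index_le) (auto simp: j nearest_def)
qed

text \<open>True at ties as well, because all minimizers have the same distance.\<close>

lemma abs_diff_closest_consistent: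
  "\<bar>u - of_int (closest_consistent k u (\<lambda>i. kth_bit i q))\<bar> = \<bar>centered_rem k (u - of_int q)\<bar>"
  unfolding closest_consistent_def diff_nearest[symmetric]
  by (rule arg_min_equality[where f = "\<lambda>j. \<bar>u - real_of_int j\<bar>"]) (auto intro: consistent_nearest nearest_le)

lemma consistent_dist_kth_bit: "consistent_dist k u (\<lambda>i. kth_bit i q) = \<bar>centered_rem k (u - of_int q)\<bar>"
  unfolding consistent_dist_def diff_nearest[symmetric]
proof (rule cInf_eq_minimum)
  show "\<bar>u - of_int (nearest k u q)\<bar> \<in> (\<lambda>j. \<bar>u - of_int j\<bar>) ` {j. consistent k (\<lambda>i. kth_bit i q) j}"
    by (intro imageI CollectI consistent_nearest)
  show "\<bar>u - of_int (nearest k u q)\<bar> \<le> x"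
    if "x \<in> (\<lambda>j. \<bar>u - of_int j\<bar>) ` {j. consistent k (\<lambda>i. kth_bit i q) j}" for x
    using that nearest_le(1) by blast
qed

lemma closest_consistent_eq_nearest:
  assumes "2 * u \<notin> \<int>"
  shows "closest_consistent k u (\<lambda>i. kth_bit i q) = nearest k u q"
  unfolding closest_consistent_def
proof (rule arg_minI)
  show "consistent k (\<lambda>i. kth_bit i q) (nearest k u q)" by (rule consistent_nearest)
  show "\<not> \<bar>u - of_int j\<bar> < \<bar>u - of_int (nearest k u q)\<bar>" if "consistent k (\<lambda>i. kth_bit i q) j" for j
    using nearest_le(1)[OF that, of u] by (simp only: not_less)
  show "j = nearest k u q" if "consistent k (\<lambda>i. kth_bit i q) j"
    "\<forall>i. consistent k (\<lambda>i. kth_bit i q) i \<longrightarrow> \<not> \<bar>u - of_int i\<bar> < \<bar>u - of_int j\<bar>" for j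
    using nearest_le(2)[OF that(1) _ assms] that(2) consistent_nearest by blast
qed

lemma countable_half_integers: "countable {u :: real. 2 * u \<in> \<int>}"
proof -
  have "{u :: real. 2 * u \<in> \<int>} = (\<lambda>n. of_int n / 2) ` UNIV" by (auto elim!: Ints_cases simp: image_iff field_simps)
  then show ?thesis by simp
qed

text \<open>The choice at ties is unspecified, but it can differ from the measurable
  \<open>nearest\<close> only on a countable set.\<close>

lemma measurable_closest_consistent [measurable]:
  "(\<lambda>u. closest_consistent k u (\<lambda>i. kth_bit i q)) \<in> measurable borel (count_space UNIV)"
proof (rule measurable_discrete_difference[OF _ countable_half_integers])
  show "(\<lambda>u. nearest k u q) \<in> measurable borel (count_space UNIV)"
    unfolding nearest_def by measurable
qed (auto simp: closest_consistent_eq_nearest)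

section \<open>Independence from characteristic functions and from the dither\<close>

text \<open>Levy's uniqueness theorem, applied to the law of \<open>U\<close> under the reweighted measure
  \<open>W / expectation W\<close>.\<close>

lemma (in prob_space) expectation_mult_of_char:
  fixes U W :: "'a \<Rightarrow> real"
  assumes U [measurable]: "random_variable borel U" and W [measurable]: "random_variable borel W"
    and W_bounds: "\<And>\<omega>. 1 \<le> W \<omega>" "\<And>\<omega>. W \<omega> \<le> B"
    and char: "\<And>\<alpha>. expectation (\<lambda>\<omega>. W \<omega> *\<^sub>R iexp (\<alpha> * U \<omega>)) = expectation W *\<^sub>R expectation (\<lambda>\<omega>. iexp (\<alpha> * U \<omega>))"
    and \<psi> [measurable]: "\<psi> \<in> borel_measurable borel"
  shows "expectation (\<lambda>\<omega>. \<psi> (U \<omega>) * W \<omega>) = expectation (\<lambda>\<omega>. \<psi> (U \<omega>)) * expectation W"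
proof -
  have W0: "0 \<le> W \<omega>" for \<omega> using W_bounds(1)[of \<omega>] by simp
  have intW: "integrable M W" using W_bounds W0 by (intro integrable_const_bound[of _ B]) auto
  define c where "c = expectation W"
  \<comment> \<open>The lower bound on \<open>W\<close> keeps the normalizing constant
    positive.\<close>
  have "1 \<le> c" unfolding c_def using intW W_bounds by (intro integral_ge_const) auto
  then have c: "c > 0" by simp
  define M' where "M' = density M (\<lambda>\<omega>. ennreal (W \<omega> / c))"
  have dens: "(\<integral>\<^sup>+ \<omega>. ennreal (W \<omega> / c) \<partial>M) = 1"
    using intW W0 c by (subst nn_integral_eq_integral) (auto simp: c_def)
  interpret M': prob_space M'
    by standard (simp add: M'_def emeasure_density dens cong: nn_integral_cong_simp)
  have U': "U \<in> borel_measurable M'" by (simp add: M'_def)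
  have "distr M' borel U = distr M borel U"
  proof (rule Levy_uniqueness)
    show "real_distribution (distr M' borel U)" by (rule M'.real_distribution_distr[OF U'])
    show "real_distribution (distr M borel U)" by (rule real_distribution_distr[OF U])
    have "char (distr M' borel U) \<alpha> = char (distr M borel U) \<alpha>" for \<alpha>
    proof -
      have "char (distr M' borel U) \<alpha> = (LINT \<omega>|M'. iexp (\<alpha> * U \<omega>))"
        using U' by (simp add: char_def integral_distr)
      also have "\<dots> = (LINT \<omega>|M. (W \<omega> / c) *\<^sub>R iexp (\<alpha> * U \<omega>))"
        unfolding M'_def using W0 c by (subst integral_density) auto
      also have "\<dots> = (LINT \<omega>|M. (1 / c) *\<^sub>R (W \<omega> *\<^sub>R iexp (\<alpha> * U \<omega>)))" by simp
      also have "\<dots> = (1 / c) *\<^sub>R (LINT \<omega>|M. W \<omega> *\<^sub>R iexp (\<alpha> * U \<omega>))" by (rule integral_scaleR_right)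
      also have "\<dots> = char (distr M borel U) \<alpha>"
        unfolding char using c by (simp add: char_def integral_distr c_def)
      finally show ?thesis .
    qed
    then show "char (distr M' borel U) = char (distr M borel U)" by (rule ext)
  qed
  then have "(LINT u|distr M' borel U. \<psi> u) = (LINT u|distr M borel U. \<psi> u)" by simp
  then have "(LINT \<omega>|M'. \<psi> (U \<omega>)) = expectation (\<lambda>\<omega>. \<psi> (U \<omega>))"
    using U' by (simp add: integral_distr)
  also have "(LINT \<omega>|M'. \<psi> (U \<omega>)) = (LINT \<omega>|M. (W \<omega> / c) *\<^sub>R \<psi> (U \<omega>))"
    unfolding M'_def using W0 c by (subst integral_density) auto
  also have "\<dots> = (LINT \<omega>|M. (1 / c) * (\<psi> (U \<omega>) * W \<omega>))" by (simp add: mult.commute)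
  also have "\<dots> = (1 / c) * expectation (\<lambda>\<omega>. \<psi> (U \<omega>) * W \<omega>)" by (rule integral_mult_right_zero)
  finally show ?thesis using c by (simp add: c_def field_simps)
qed

text \<open>Since \<open>e\<close> is even, the joint formula at \<open>t\<close> and
  \<open>- t\<close> separates the cosine and sine parts of \<open>D\<close>. Each part then factors
  against all exponentials in \<open>U\<close>, and \<open>expectation_mult_of_char\<close> extends
  this to bounded \<open>\<psi>\<close>.\<close>

lemma (in prob_space) trig_moments_of_joint_char:
  fixes U D :: "'a \<Rightarrow> real"
  assumes U [measurable]: "random_variable borel U" and D [measurable]: "random_variable borel D"
    and joint: "\<And>\<alpha> t. expectation (\<lambda>\<omega>. iexp (\<alpha> * U \<omega> + t * D \<omega>)) = expectation (\<lambda>\<omega>. iexp (\<alpha> * U \<omega>)) * of_real (e t)"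
    and even: "\<And>t. e (- t) = e t"
    and \<psi> [measurable]: "\<psi> \<in> borel_measurable borel" "\<And>u. \<bar>\<psi> u\<bar> \<le> (1::real)"
  shows "expectation (\<lambda>\<omega>. \<psi> (U \<omega>) * cos (t * D \<omega>)) = expectation (\<lambda>\<omega>. \<psi> (U \<omega>)) * e t"
    and "expectation (\<lambda>\<omega>. \<psi> (U \<omega>) * sin (t * D \<omega>)) = 0"
proof -
  have ib: "integrable M f" if "f \<in> borel_measurable M" "\<And>\<omega>. norm (f \<omega>) \<le> 1" for f :: "'a \<Rightarrow> 'b :: {banach, second_countable_topology}"
    using that by (intro integrable_const_bound[of _ 1]) auto
  have int [simp]: "integrable M (\<lambda>\<omega>. iexp (\<alpha> * U \<omega> + t * D \<omega>))" "integrable M (\<lambda>\<omega>. iexp (\<alpha> * U \<omega>))" for \<alpha> t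
    by (auto intro!: ib simp: norm_exp_i_times)
  have intc [simp]: "integrable M (\<lambda>\<omega>. cos (t * D \<omega>) *\<^sub>R iexp (\<alpha> * U \<omega>))"
     "integrable M (\<lambda>\<omega>. sin (t * D \<omega>) *\<^sub>R iexp (\<alpha> * U \<omega>))"
     "integrable M (\<lambda>\<omega>. cos (t * D \<omega>))" "integrable M (\<lambda>\<omega>. sin (t * D \<omega>))" for \<alpha> t
    by (auto intro!: ib simp: norm_mult)
  have \<psi>int [simp]: "integrable M (\<lambda>\<omega>. \<psi> (U \<omega>))" "integrable M (\<lambda>\<omega>. \<psi> (U \<omega>) * cos (t * D \<omega>))"
     "integrable M (\<lambda>\<omega>. \<psi> (U \<omega>) * sin (t * D \<omega>))"
    using \<psi>(2) by (auto intro!: ib mult_le_one simp: abs_mult)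
  have split: "iexp (\<alpha> * U \<omega> + t * D \<omega>) = cos (t * D \<omega>) *\<^sub>R iexp (\<alpha> * U \<omega>) + \<i> * (sin (t * D \<omega>) *\<^sub>R iexp (\<alpha> * U \<omega>))" for \<alpha> t \<omega>
  proof -
    have "iexp (\<alpha> * U \<omega> + t * D \<omega>) = iexp (\<alpha> * U \<omega>) * iexp (t * D \<omega>)"
      by (simp add: exp_add[symmetric] distrib_left)
    also have "iexp (t * D \<omega>) = of_real (cos (t * D \<omega>)) + \<i> * of_real (sin (t * D \<omega>))"
      by (simp only: exp_Euler cos_of_real sin_of_real)
    finally show ?thesis by (simp only: scaleR_conv_of_real) (simp only: algebra_simps)
  qed
  define C where "C \<alpha> = expectation (\<lambda>\<omega>. cos (t * D \<omega>) *\<^sub>R iexp (\<alpha> * U \<omega>))" for \<alpha>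
  define S where "S \<alpha> = expectation (\<lambda>\<omega>. sin (t * D \<omega>) *\<^sub>R iexp (\<alpha> * U \<omega>))" for \<alpha>
  define \<Phi> where "\<Phi> \<alpha> = expectation (\<lambda>\<omega>. iexp (\<alpha> * U \<omega>))" for \<alpha>
  have lin: "expectation (\<lambda>\<omega>. f \<omega> + \<i> * g \<omega>) = expectation f + \<i> * expectation g"
    if "integrable M f" "integrable M g" for f g :: "'a \<Rightarrow> complex"
    using that by simp
  have lin2: "expectation (\<lambda>\<omega>. 2 *\<^sub>R f \<omega> + g \<omega>) = 2 * expectation f + expectation g"
    if "integrable M f" "integrable M g" for f g :: "'a \<Rightarrow> complex"
    using that by (simp add: scaleR_conv_of_real)
  have p: "C \<alpha> + \<i> * S \<alpha> = \<Phi> \<alpha> * of_real (e t)" for \<alpha>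
  proof -
    have "expectation (\<lambda>\<omega>. iexp (\<alpha> * U \<omega> + t * D \<omega>)) = C \<alpha> + \<i> * S \<alpha>"
      unfolding split C_def S_def by (rule lin[OF intc(1,2)])
    then show ?thesis using joint[of \<alpha> t] by (simp add: \<Phi>_def)
  qed
  have m: "C \<alpha> - \<i> * S \<alpha> = \<Phi> \<alpha> * of_real (e t)" for \<alpha>
  proof -
    have "iexp (\<alpha> * U \<omega> + (- t) * D \<omega>)
        = cos (t * D \<omega>) *\<^sub>R iexp (\<alpha> * U \<omega>) + \<i> * (- (sin (t * D \<omega>) *\<^sub>R iexp (\<alpha> * U \<omega>)))" for \<omega>
      using split[of \<alpha> \<omega> "- t"] by (simp only: mult_minus_left cos_minus sin_minus scaleR_minus_left)
    then have "expectation (\<lambda>\<omega>. iexp (\<alpha> * U \<omega> + (- t) * D \<omega>)) = C \<alpha> + \<i> * (- S \<alpha>)"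
      unfolding C_def S_def integral_minus[symmetric]
      by (simp only: lin[OF intc(1) Bochner_Integration.integrable_minus[OF intc(2)]])
    then show ?thesis using joint[of \<alpha> "- t"] by (simp add: \<Phi>_def even)
  qed
  \<comment> \<open>Sum and difference of the formulas for \<open>t\<close> and
    \<open>- t\<close>.\<close>
  have "2 * C \<alpha> = 2 * (\<Phi> \<alpha> * of_real (e t))" "2 * (\<i> * S \<alpha>) = 0" for \<alpha>
    using p[of \<alpha>] m[of \<alpha>] by (auto simp: algebra_simps)
  then have C: "C \<alpha> = \<Phi> \<alpha> * of_real (e t)" and S: "S \<alpha> = 0" for \<alpha> by auto
  have \<Phi>0: "\<Phi> 0 = 1" by (simp add: \<Phi>_def prob_space)
  have "complex_of_real (expectation (\<lambda>\<omega>. cos (t * D \<omega>))) = of_real (e t)"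
    using C[of 0] unfolding \<Phi>0 by (simp add: C_def scaleR_conv_of_real)
  then have Ec: "expectation (\<lambda>\<omega>. cos (t * D \<omega>)) = e t" by (simp only: of_real_eq_iff)
  have "complex_of_real (expectation (\<lambda>\<omega>. sin (t * D \<omega>))) = 0"
    using S[of 0] by (simp add: S_def scaleR_conv_of_real)
  then have Es: "expectation (\<lambda>\<omega>. sin (t * D \<omega>)) = 0" by simp
  \<comment> \<open>Adding 2 makes the cosine an admissible weight with values in
    \<open>[1, 3]\<close>; the constant is subtracted again by linearity.\<close>
  have "expectation (\<lambda>\<omega>. \<psi> (U \<omega>) * (2 + cos (t * D \<omega>))) = expectation (\<lambda>\<omega>. \<psi> (U \<omega>)) * expectation (\<lambda>\<omega>. 2 + cos (t * D \<omega>))"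
  proof (rule expectation_mult_of_char[where U = U and \<psi> = \<psi> and B = 3])
    show "1 \<le> 2 + cos (t * D \<omega>)" "2 + cos (t * D \<omega>) \<le> 3" for \<omega>
      using cos_ge_minus_one[of "t * D \<omega>"] cos_le_one[of "t * D \<omega>"] by linarith+
    have "expectation (\<lambda>\<omega>. (2 + cos (t * D \<omega>)) *\<^sub>R iexp (\<alpha> * U \<omega>)) = 2 * \<Phi> \<alpha> + C \<alpha>" for \<alpha>
      unfolding scaleR_left_distrib C_def \<Phi>_def by (rule lin2[OF int(2) intc(1)])
    then show "expectation (\<lambda>\<omega>. (2 + cos (t * D \<omega>)) *\<^sub>R iexp (\<alpha> * U \<omega>))
       = expectation (\<lambda>\<omega>. 2 + cos (t * D \<omega>)) *\<^sub>R expectation (\<lambda>\<omega>. iexp (\<alpha> * U \<omega>))" for \<alpha>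
      by (simp add: C Ec prob_space \<Phi>_def scaleR_conv_of_real algebra_simps)
  qed auto
  then show "expectation (\<lambda>\<omega>. \<psi> (U \<omega>) * cos (t * D \<omega>)) = expectation (\<lambda>\<omega>. \<psi> (U \<omega>)) * e t"
    by (simp add: distrib_left Ec prob_space)
  have "expectation (\<lambda>\<omega>. \<psi> (U \<omega>) * (2 + sin (t * D \<omega>))) = expectation (\<lambda>\<omega>. \<psi> (U \<omega>)) * expectation (\<lambda>\<omega>. 2 + sin (t * D \<omega>))"
  proof (rule expectation_mult_of_char[where U = U and \<psi> = \<psi> and B = 3])
    show "1 \<le> 2 + sin (t * D \<omega>)" "2 + sin (t * D \<omega>) \<le> 3" for \<omega>
      using sin_ge_minus_one[of "t * D \<omega>"] sin_le_one[of "t * D \<omega>"] by linarith+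
    have "expectation (\<lambda>\<omega>. (2 + sin (t * D \<omega>)) *\<^sub>R iexp (\<alpha> * U \<omega>)) = 2 * \<Phi> \<alpha> + S \<alpha>" for \<alpha>
      unfolding scaleR_left_distrib S_def \<Phi>_def by (rule lin2[OF int(2) intc(2)])
    then show "expectation (\<lambda>\<omega>. (2 + sin (t * D \<omega>)) *\<^sub>R iexp (\<alpha> * U \<omega>))
       = expectation (\<lambda>\<omega>. 2 + sin (t * D \<omega>)) *\<^sub>R expectation (\<lambda>\<omega>. iexp (\<alpha> * U \<omega>))" for \<alpha>
      by (simp add: S Es prob_space \<Phi>_def scaleR_conv_of_real)
  qed auto
  then show "expectation (\<lambda>\<omega>. \<psi> (U \<omega>) * sin (t * D \<omega>)) = 0"
    by (simp add: distrib_left Es prob_space)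
qed

text \<open>The interval \<open>[-1, 0)\<close> is one full period of \<open>frac\<close>. With
  \<open>v' = frac v\<close>, its parts left and right of \<open>- v'\<close> are translated onto
  \<open>[v', 1)\<close> and \<open>[0, v')\<close>.\<close>

lemma integral_frac_shift:
  fixes \<psi> :: "real \<Rightarrow> real"
  assumes [measurable]: "\<psi> \<in> borel_measurable borel" and \<psi>: "\<And>u. \<bar>\<psi> u\<bar> \<le> 1"
  shows "(LINT x|lborel. indicator {-1..<0} x * \<psi> (frac (v + x))) = (LINT x|lborel. indicator {0..<1} x * \<psi> x)"
proof -
  define v' where "v' = frac v"
  have v': "0 \<le> v'" "v' < 1" by (simp_all add: v'_def frac_lt_1)
  have fr: "frac (v + x) = frac (v' + x)" for x
  proof -
    show ?thesis by (simp add: v'_def)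
  qed
  have f1: "frac (v' + x) = v' + 1 + x" if "x \<in> {-1..<-v'}" for x
    using that v' by (intro frac_unique_iff[THEN iffD2]) (auto intro: Ints_minus simp: algebra_simps)
  have f2: "frac (v' + x) = v' + x" if "x \<in> {-v'..<0}" for x
    using that v' by (intro frac_unique_iff[THEN iffD2]) (auto simp: algebra_simps)
  have int: "integrable lborel (\<lambda>x. indicator {a..<b} (c + x) * \<psi> (c + x))" for a b c :: real
  proof -
    have "integrable lborel (\<lambda>x. indicator {a..<b} x * \<psi> x)"
      using integrableI_bounded_set_indicator[of "{a..<b}" lborel \<psi> 1] \<psi> by (cases "a \<le> b") auto
    from lborel_integrable_real_affine[OF this, of 1 c] show ?thesis by simp
  qed
  have shift: "(LINT x|lborel. indicator {a..<b} (c + x) * \<psi> (c + x)) = (LINT x|lborel. indicator {a..<b} x * \<psi> x)" for a b c :: real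
    using lborel_integral_real_affine[of 1 "\<lambda>x. indicator {a..<b} x * \<psi> x" c] by simp
  have "indicator {-1..<0} x * \<psi> (frac (v + x))
    = indicator {v'..<1} (v' + 1 + x) * \<psi> (v' + 1 + x) + indicator {0..<v'} (v' + x) * \<psi> (v' + x)" for x
    using f1[of x] f2[of x] v' unfolding fr by (auto simp: indicator_def)
  then have "(LINT x|lborel. indicator {-1..<0} x * \<psi> (frac (v + x)))
    = (LINT x|lborel. indicator {v'..<1} (v' + 1 + x) * \<psi> (v' + 1 + x)) + (LINT x|lborel. indicator {0..<v'} (v' + x) * \<psi> (v' + x))"
    using int by simp
  also have "\<dots> = (LINT x|lborel. indicator {v'..<1} x * \<psi> x + indicator {0..<v'} x * \<psi> x)"
    unfolding shift using int[of _ _ 0] by simp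
  also have "\<dots> = (LINT x|lborel. indicator {0..<1} x * \<psi> x)"
    using v' by (intro Bochner_Integration.integral_cong) (auto simp: indicator_def)
  finally show ?thesis .
qed

text \<open>By Fubini and \<open>integral_frac_shift\<close> the inner integral over the dither is
  the same for every \<open>v\<close>. So the fractional part is uniform and independent of
  \<open>Z\<close>, however \<open>v\<close> depends on \<open>Z\<close>. The map \<open>e\<close>
  reads the dither off a \<open>W\<close> with values in a general space, such as a restricted
  family.\<close>

lemma (in prob_space) expectation_frac_dither:
  fixes e \<psi> \<xi> v :: "_ \<Rightarrow> real"
  assumes w: "distributed M lborel (\<lambda>\<omega>. e (W \<omega>)) (indicator {-1..<0})" and ind: "indep_var K W N Z"
    and [measurable]: "e \<in> borel_measurable K"
    and [measurable]: "v \<in> borel_measurable N" "\<xi> \<in> borel_measurable N" "\<psi> \<in> borel_measurable borel"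
    and \<psi>: "\<And>u. \<bar>\<psi> u\<bar> \<le> 1" and \<xi>: "\<And>z. \<bar>\<xi> z\<bar> \<le> 1"
  shows "expectation (\<lambda>\<omega>. \<psi> (frac (v (Z \<omega>) + e (W \<omega>))) * \<xi> (Z \<omega>))
    = (LINT x|lborel. indicator {0..<1} x * \<psi> x) * expectation (\<lambda>\<omega>. \<xi> (Z \<omega>))"
proof -
  have [measurable]: "random_variable K W" "random_variable N Z"
    using ind by (auto dest: indep_var_rv1 indep_var_rv2)
  have eq: "distr M K W \<Otimes>\<^sub>M distr M N Z = distr M (K \<Otimes>\<^sub>M N) (\<lambda>\<omega>. (W \<omega>, Z \<omega>))"
    using ind by (simp add: indep_var_distribution_eq)
  interpret W: prob_space "distr M K W" by (rule prob_space_distr) simp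
  interpret Z: prob_space "distr M N Z" by (rule prob_space_distr) simp
  interpret P: pair_prob_space "distr M K W" "distr M N Z" ..
  have [measurable]: "frac \<in> borel_measurable (borel :: real measure)" unfolding frac_def[abs_def] by measurable
  have Wlaw: "distr M borel (\<lambda>\<omega>. e (W \<omega>)) = density lborel (indicator {-1..<0})"
    using distributed_distr_eq_density[OF w] by (simp cong: distr_cong)
  let ?f = "\<lambda>(x, z). \<psi> (frac (v z + e x)) * \<xi> z :: real"
  have "expectation (\<lambda>\<omega>. \<psi> (frac (v (Z \<omega>) + e (W \<omega>))) * \<xi> (Z \<omega>))
    = (LINT p|(distr M K W \<Otimes>\<^sub>M distr M N Z). ?f p)"
    unfolding eq by (subst integral_distr) (auto simp: split_beta)
  also have "\<dots> = (LINT z|distr M N Z. LINT x|distr M K W. ?f (x, z))"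
  proof -
    have "\<bar>?f p\<bar> \<le> 1" for p
      using \<psi> \<xi> by (auto simp: split_beta abs_mult intro!: mult_le_one)
    then have "integrable (distr M K W \<Otimes>\<^sub>M distr M N Z) ?f"
      by (intro P.integrable_const_bound[of _ 1]) auto
    from P.integral_snd[OF this] show ?thesis by simp
  qed
  also have "\<dots> = (LINT z|distr M N Z. (LINT x|lborel. indicator {0..<1} x * \<psi> x) * \<xi> z)"
  proof (rule Bochner_Integration.integral_cong)
    fix z
    have "(LINT x|distr M K W. \<psi> (frac (v z + e x))) = (LINT x|distr M borel (\<lambda>\<omega>. e (W \<omega>)). \<psi> (frac (v z + x)))"
      by (simp add: integral_distr)
    also have "\<dots> = (LINT x|lborel. indicator {-1..<0} x *\<^sub>R \<psi> (frac (v z + x)))"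
      unfolding Wlaw by (subst integral_density[symmetric]) (auto simp: ennreal_indicator)
    also have "\<dots> = (LINT x|lborel. indicator {0..<1} x * \<psi> x)"
      using integral_frac_shift[OF assms(6) \<psi>, of "v z"] by simp
    finally show "(LINT x|distr M K W. ?f (x, z)) = (LINT x|lborel. indicator {0..<1} x * \<psi> x) * \<xi> z"
      by simp
  qed simp
  also have "\<dots> = (LINT x|lborel. indicator {0..<1} x * \<psi> x) * expectation (\<lambda>\<omega>. \<xi> (Z \<omega>))"
    by (simp add: integral_distr)
  finally show ?thesis .
qed

text \<open>The uniform fractional part almost surely avoids the values 0 and
  \<open>1 / 2\<close>.\<close>

lemma (in prob_space) AE_dither_not_half_integer:
  fixes e v :: "_ \<Rightarrow> real"
  assumes w: "distributed M lborel (\<lambda>\<omega>. e (W \<omega>)) (indicator {-1..<0})" and ind: "indep_var K W N Z"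
    and [measurable]: "e \<in> borel_measurable K"
    and [measurable]: "v \<in> borel_measurable N"
  shows "AE \<omega> in M. 2 * (v (Z \<omega>) + e (W \<omega>)) \<notin> \<int>"
proof -
  have [measurable]: "random_variable K W" "random_variable N Z"
    using ind by (auto dest: indep_var_rv1 indep_var_rv2)
  have [measurable]: "frac \<in> borel_measurable (borel :: real measure)" unfolding frac_def[abs_def] by measurable
  let ?y = "\<lambda>\<omega>. v (Z \<omega>) + e (W \<omega>)"
  have "expectation (\<lambda>\<omega>. indicator {0, 1 / 2 :: real} (frac (?y \<omega>)) * 1) = (LINT x|lborel. indicator {0..<1} x * indicator {0, 1 / 2 :: real} x :: real) * expectation (\<lambda>_. 1)"
    by (rule expectation_frac_dither[OF w ind]) (auto simp: indicator_def)
  also have "(LINT x|lborel. indicator {0..<1} x * indicator {0, 1 / 2 :: real} x) = (LINT x|lborel. indicator {0, 1 / 2 :: real} x :: real)"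
    by (intro Bochner_Integration.integral_cong) (auto simp: indicator_def)
  also have "\<dots> = 0" by (simp add: measure_def emeasure_lborel_countable)
  finally have "expectation (\<lambda>\<omega>. indicator {0, 1 / 2 :: real} (frac (?y \<omega>))) = (0 :: real)" by simp
  then have "AE \<omega> in M. indicator {0, 1 / 2 :: real} (frac (?y \<omega>)) = (0 :: real)"
    by (subst (asm) integral_nonneg_eq_0_iff_AE) (auto intro!: integrable_const_bound[of _ 1])
  then show ?thesis
  proof eventually_elim
    case (elim \<omega>)
    show ?case
    proof
      assume "2 * ?y \<omega> \<in> \<int>"
      then obtain n where n: "2 * ?y \<omega> = of_int n" by (elim Ints_cases)
      have "frac (?y \<omega>) = 0 \<or> frac (?y \<omega>) = 1 / 2"
      proof (cases "even n")
        case True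
        then obtain m where "n = 2 * m" by (elim evenE)
        then have "?y \<omega> = of_int m" using n by simp
        then show ?thesis by (simp only: frac_of_int) simp
      next
        case False
        then obtain m where "n = 2 * m + 1" by (elim oddE)
        then have "?y \<omega> = 1 / 2 + of_int m" using n by simp
        then have "frac (?y \<omega>) = frac (1 / 2)" by (simp add: frac_def)
        then show ?thesis by (simp add: frac_eq)
      qed
      then show False using elim by (auto simp: indicator_def)
    qed
  qed
qed

text \<open>The standard normal characteristic function is evaluated at
  \<open>\<sigma> * a * t\<close>; this covers \<open>a = 0\<close>, where the product has no
  density.\<close>

lemma char_normal_cmult:
  assumes M: "prob_space M" and \<sigma>: "\<sigma> > 0" and X: "distributed M lborel X (normal_density 0 \<sigma>)"
  shows "char (distr M borel (\<lambda>\<omega>. a * X \<omega>)) t = of_real (exp (- (1 / 2) * (\<sigma> * a * t)\<^sup>2))"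
proof -
  interpret prob_space M by fact
  have [measurable]: "X \<in> borel_measurable M" using X by (auto dest: distributed_measurable)
  have "distributed M lborel (\<lambda>\<omega>. (X \<omega> - 0) / \<sigma>) std_normal_density"
    using normal_standard_normal_convert[OF \<sigma>, of X 0] X by simp
  then have "distributed M lborel (\<lambda>\<omega>. X \<omega> / \<sigma>) std_normal_density" by simp
  then have "distr M lborel (\<lambda>\<omega>. X \<omega> / \<sigma>) = std_normal_distribution"
    by (rule distributed_distr_eq_density)
  then have "distr M borel (\<lambda>\<omega>. X \<omega> / \<sigma>) = std_normal_distribution" by (simp cong: distr_cong)
  then have "char (distr M borel (\<lambda>\<omega>. X \<omega> / \<sigma>)) (\<sigma> * a * t) = of_real (exp (- (\<sigma> * a * t)\<^sup>2 / 2))"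
    by (simp add: char_std_normal_distribution)
  then show ?thesis using \<sigma> by (simp add: char_def integral_distr mult_ac)
qed

section \<open>The conditional likelihood of error\<close>

text \<open>Common to both conditionings: once every event of \<open>F\<close> is, up to a null set,
  a condition on \<open>U\<close> selected by the known residue,
  \<open>expectation_error_minus_likelihood\<close> equates the integrals of \<open>E\<close> and
  \<open>g\<close> over it, which characterizes the conditional expectation.\<close>

lemma (in noise_prediction) real_cond_exp_error:
  fixes E :: "'w set" and g :: "'w \<Rightarrow> real"
  defines "Q \<equiv> \<lambda>\<omega>. quantize (U \<omega> + D \<omega>)"
  assumes F: "subalgebra M F" and E [measurable]: "E \<in> sets M" and g: "g \<in> borel_measurable F"
    and E_eq: "AE \<omega> in M. \<omega> \<in> E \<longleftrightarrow> odd (step_index k (U \<omega> - of_int (Q \<omega>)))"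
    and g_eq: "\<And>\<omega>. \<omega> \<in> space M \<Longrightarrow> g \<omega> = likelihood s k (centered_rem k (U \<omega> - of_int (Q \<omega>)))"
    and sets_F: "\<And>B. B \<in> sets F \<Longrightarrow> \<exists>S. (\<forall>\<rho>. S \<rho> \<in> sets borel) \<and> (AE \<omega> in M. \<omega> \<in> B \<longleftrightarrow> U \<omega> \<in> S (Q \<omega> mod 2 ^ (k - 1)))"
  shows "AE \<omega> in M. real_cond_exp M F (indicator E) \<omega> = g \<omega>"
proof -
  interpret finite_measure_subalgebra M F by standard (rule F)
  have gM [measurable]: "g \<in> borel_measurable M" by (rule measurable_from_subalg[OF F g])
  have [measurable]: "Q \<in> measurable M (count_space UNIV)" unfolding Q_def by measurable
  have g_bounds: "0 \<le> g \<omega>" "g \<omega> \<le> 1" if "\<omega> \<in> space M" for \<omega>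
    using likelihood_bounds g_eq[OF that] by auto
  have int_g: "integrable M g"
    using g_bounds by (intro integrable_const_bound[of _ 1]) auto
  have int_E: "integrable M (indicator E :: 'w \<Rightarrow> real)"
    by (intro integrable_const_bound[of _ 1]) auto
  show ?thesis
  proof (rule real_cond_exp_charact[OF _ int_E int_g g])
    fix B assume B: "B \<in> sets F"
    then have BM [measurable]: "B \<in> sets M" using F by (auto simp: subalgebra_def)
    obtain S where S: "\<And>\<rho>. S \<rho> \<in> sets borel" and B_eq: "AE \<omega> in M. \<omega> \<in> B \<longleftrightarrow> U \<omega> \<in> S (Q \<omega> mod 2 ^ (k - 1))"
      using sets_F[OF B] by blast
    have [measurable]: "(\<lambda>\<omega>. U \<omega> \<in> S (Q \<omega> mod 2 ^ (k - 1))) \<in> measurable M (count_space UNIV)"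
      by (rule measurable_compose_countable[where g = Q]) (use S in measurable)
    have "0 = expectation (\<lambda>\<omega>. of_bool (U \<omega> \<in> S (Q \<omega> mod 2 ^ (k - 1)))
      * (of_bool (odd (step_index k (U \<omega> - of_int (Q \<omega>)))) - likelihood s k (centered_rem k (U \<omega> - of_int (Q \<omega>)))))"
      unfolding Q_def by (rule expectation_error_minus_likelihood[OF S, symmetric])
    also have "\<dots> = expectation (\<lambda>\<omega>. indicator B \<omega> * (indicator E \<omega> - g \<omega>))"
    proof (rule integral_cong_AE)
      show "AE \<omega> in M. of_bool (U \<omega> \<in> S (Q \<omega> mod 2 ^ (k - 1)))
        * (of_bool (odd (step_index k (U \<omega> - of_int (Q \<omega>)))) - likelihood s k (centered_rem k (U \<omega> - of_int (Q \<omega>))))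
        = indicator B \<omega> * (indicator E \<omega> - g \<omega>)"
        using E_eq B_eq AE_space by eventually_elim (auto simp: g_eq indicator_def)
    qed (unfold of_bool_def, measurable)
    also have "\<dots> = (LINT \<omega>:B|M. indicator E \<omega>) - (LINT \<omega>:B|M. g \<omega>)"
      using integrable_mult_indicator[OF BM int_E] integrable_mult_indicator[OF BM int_g]
      by (simp add: set_lebesgue_integral_def right_diff_distrib)
    finally show "(LINT \<omega>:B|M. indicator E \<omega>) = (LINT \<omega>:B|M. g \<omega> :: real)" by simp
  qed
qed

text \<open>By independence the characteristic function of the sum factors, and the squares in the
  Gaussian exponents add up to the squared norm of \<open>\<gamma>\<close>.\<close>

lemma (in prob_space) gaussian_row_char:
  fixes A :: "'a \<Rightarrow> real^'n^'m" and w :: "'a \<Rightarrow> real^'m"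
  assumes \<sigma>: "\<sigma> > 0"
    and A: "\<And>i j. distributed M lborel (\<lambda>\<omega>. A \<omega> $ i $ j) (normal_density 0 \<sigma>)"
    and ind: "indep_vars (\<lambda>_. borel) (case_sum (\<lambda>(i, j) \<omega>. A \<omega> $ i $ j) (\<lambda>i \<omega>. w \<omega> $ i)) UNIV"
  shows "expectation (\<lambda>\<omega>. iexp ((\<Sum>j\<in>UNIV. A \<omega> $ r $ j * \<gamma> $ j) + \<beta> * w \<omega> $ r))
    = of_real (exp (- (1 / 2) * (\<sigma> * norm \<gamma>)\<^sup>2)) * expectation (\<lambda>\<omega>. iexp (\<beta> * w \<omega> $ r))"
proof -
  let ?X = "case_sum (\<lambda>(i, j) \<omega>. A \<omega> $ i $ j) (\<lambda>i \<omega>. w \<omega> $ i)"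
  define Y :: "('m \<times> 'n) + 'm \<Rightarrow> real \<Rightarrow> real" where "Y = case_sum (\<lambda>(i, j) x. \<gamma> $ j * x) (\<lambda>i x. \<beta> * x)"
  \<comment> \<open>The entries of row \<open>r\<close> of the matrix and the dither entry
    \<open>r\<close>; the coefficients sit in \<open>Y\<close>, so the frequency is 1.\<close>
  define I :: "(('m \<times> 'n) + 'm) set" where "I = insert (Inr r) ((\<lambda>j. Inl (r, j)) ` UNIV)"
  have [measurable]: "random_variable borel (?X i)" for i
    using ind by (auto simp: indep_vars_def)
  have meas: "random_variable borel (\<lambda>\<omega>. A \<omega> $ i $ j)" "random_variable borel (\<lambda>\<omega>. w \<omega> $ i)" for i j
    using \<open>random_variable borel (?X (Inl (i, j)))\<close> \<open>random_variable borel (?X (Inr i))\<close> by auto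
  note meas [measurable]
  have "indep_vars (\<lambda>_. borel) (\<lambda>i \<omega>. Y i (?X i \<omega>)) UNIV"
    by (rule indep_vars_compose2[OF ind]) (auto simp: Y_def split: sum.split)
  then have "indep_vars (\<lambda>_. borel) (\<lambda>i \<omega>. Y i (?X i \<omega>)) I" by (rule indep_vars_subset) simp
  then have c: "char (distr M borel (\<lambda>\<omega>. \<Sum>i\<in>I. Y i (?X i \<omega>))) 1 = (\<Prod>i\<in>I. char (distr M borel (\<lambda>\<omega>. Y i (?X i \<omega>))) 1)"
    by (rule char_distr_sum)
  have inj: "inj (\<lambda>j. Inl (r, j))" by (auto simp: inj_def)
  have sum: "(\<Sum>i\<in>I. Y i (?X i \<omega>)) = (\<Sum>j\<in>UNIV. A \<omega> $ r $ j * \<gamma> $ j) + \<beta> * w \<omega> $ r" for \<omega>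
    unfolding I_def by (subst sum.insert) (auto simp: sum.reindex[OF inj] Y_def mult.commute)
  have "(\<Prod>i\<in>I. char (distr M borel (\<lambda>\<omega>. Y i (?X i \<omega>))) 1)
    = char (distr M borel (\<lambda>\<omega>. \<beta> * w \<omega> $ r)) 1 * (\<Prod>j\<in>UNIV. char (distr M borel (\<lambda>\<omega>. \<gamma> $ j * A \<omega> $ r $ j)) 1)"
    unfolding I_def by (subst prod.insert) (auto simp: prod.reindex[OF inj] Y_def)
  also have "(\<Prod>j\<in>UNIV. char (distr M borel (\<lambda>\<omega>. \<gamma> $ j * A \<omega> $ r $ j)) 1)
    = (\<Prod>j\<in>UNIV. complex_of_real (exp (- (1 / 2) * (\<sigma> * \<gamma> $ j * 1)\<^sup>2)))"
    by (intro prod.cong refl char_normal_cmult prob_space_axioms \<sigma> A)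
  also have "\<dots> = of_real (exp (\<Sum>j\<in>UNIV. - (1 / 2) * (\<sigma> * \<gamma> $ j * 1)\<^sup>2))"
    by (simp add: exp_sum)
  also have "(\<Sum>j\<in>UNIV. - (1 / 2) * (\<sigma> * \<gamma> $ j * 1)\<^sup>2) = - (1 / 2) * (\<sigma> * norm \<gamma>)\<^sup>2"
    by (simp add: power_mult_distrib norm_vec_def L2_set_def sum_nonneg sum_distrib_left sum_negf)
  finally show ?thesis using c unfolding sum
    by (simp add: char_def integral_distr mult.commute)
qed

lemma kth_bit_mod:
  assumes "i \<in> {1..<k}"
  shows "kth_bit i (q mod 2 ^ (k - 1)) = kth_bit i q"
proof -
  have "consistent k (\<lambda>i. kth_bit i q) (q mod 2 ^ (k - 1))"
    unfolding consistent_kth_bit_iff by (metis dvd_minus_mod dvd_diff_commute)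
  then show ?thesis using assms by (auto simp: consistent_def)
qed

lemma centered_rem_mod: "centered_rem k (u - of_int (q mod 2 ^ (k - 1))) = centered_rem k (u - of_int q)"
proof -
  have "real_of_int (q mod 2 ^ (k - 1)) = of_int q - 2 ^ (k - 1) * of_int (q div 2 ^ (k - 1))"
    by (simp add: minus_mult_div_eq_mod[symmetric])
  then have "u - of_int (q mod 2 ^ (k - 1)) = (u - of_int q) + 2 ^ (k - 1) * of_int (q div 2 ^ (k - 1))" by simp
  then show ?thesis by (simp only: centered_rem_add)
qed

lemma predicted_bit_neq_iff:
  assumes "2 * u \<notin> \<int>"
  shows "predicted_bit k u (\<lambda>i. kth_bit i q) \<noteq> kth_bit k q \<longleftrightarrow> odd (step_index k (u - of_int q))"
  unfolding predicted_bit_def closest_consistent_eq_nearest[OF assms] nearest_def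
  by (rule kth_bit_add_neq_iff)

theorem theorem2:
  fixes M :: "'w measure"
    and A :: "'w \<Rightarrow> real^'n^'m" and w :: "'w \<Rightarrow> real^'m"
    and x xhat :: "real^'n" and \<sigma> \<Delta> \<epsilon> :: real
    and k :: nat and r :: 'm
    and y yhat c :: "'w \<Rightarrow> real" and q :: "'w \<Rightarrow> nat \<Rightarrow> int" and qhat :: "'w \<Rightarrow> int"
    and E :: "'w set"
  assumes "prob_space M" and "\<Delta> > 0" and "\<sigma> > 0" and "k \<ge> 1"
    and "\<And>i j. distributed M lborel (\<lambda>\<omega>. A \<omega> $ i $ j) (normal_density 0 \<sigma>)"
    and "\<And>i. distributed M lborel (\<lambda>\<omega>. w \<omega> $ i) (indicator {-1..<0})"
    and "prob_space.indep_vars M (\<lambda>_. borel)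
           (case_sum (\<lambda>(i, j) \<omega>. A \<omega> $ i $ j) (\<lambda>i \<omega>. w \<omega> $ i)) (UNIV :: (('m \<times> 'n) + 'm) set)"
    and "\<epsilon> = norm (x - xhat)"
    and "\<And>\<omega>. y \<omega> = measurement \<Delta> (A \<omega>) (w \<omega>) x $ r"
    and "\<And>\<omega>. yhat \<omega> = measurement \<Delta> (A \<omega>) (w \<omega>) xhat $ r"
    and "\<And>\<omega> i. q \<omega> i = kth_bit i (quantize (y \<omega>))"
    and "\<And>\<omega>. qhat \<omega> = predicted_bit k (yhat \<omega>) (q \<omega>)"
    and "\<And>\<omega>. c \<omega> = consistent_dist k (yhat \<omega>) (q \<omega>)"
    and "E = {\<omega> \<in> space M. qhat \<omega> \<noteq> q \<omega> k}"
  shows "(AE \<omega> in M. real_cond_exp M (sigma_offset M k yhat q) (indicator E) \<omega>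
            = A2 \<sigma> \<epsilon> \<Delta> k (c \<omega>) / (A1 \<sigma> \<epsilon> \<Delta> k (c \<omega>) + A2 \<sigma> \<epsilon> \<Delta> k (c \<omega>)))
       \<and> (xhat \<bullet> (x - xhat) = 0 \<longrightarrow>
          (AE \<omega> in M. real_cond_exp M (sigma_known M k yhat q) (indicator E) \<omega>
            = A2 \<sigma> \<epsilon> \<Delta> k (c \<omega>) / (A1 \<sigma> \<epsilon> \<Delta> k (c \<omega>) + A2 \<sigma> \<epsilon> \<Delta> k (c \<omega>))))"
proof -
  interpret prob_space M by fact
  note \<Delta> = assms(2) and \<sigma> = assms(3) and k = assms(4) and A = assms(5) and w = assms(6) and ind = assms(7)
  \<comment> \<open>The standard deviation of \<open>D\<close>, which applies the Gaussian row to a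
    vector of norm \<open>\<epsilon> / \<Delta>\<close>.\<close>
  define s where "s = \<sigma> * \<epsilon> / \<Delta>"
  define P :: int where "P = 2 ^ (k - 1)"
  have P: "P > 0" by (simp add: P_def)
  let ?X = "case_sum (\<lambda>(i, j) \<omega>. A \<omega> $ i $ j) (\<lambda>i \<omega>. w \<omega> $ i)"
  have rvX: "random_variable borel (?X i)" for i
    using ind by (auto simp: indep_vars_def)
  have meas: "random_variable borel (\<lambda>\<omega>. A \<omega> $ i $ j)" "random_variable borel (\<lambda>\<omega>. w \<omega> $ i)" for i j
    using rvX[of "Inl (i, j)"] rvX[of "Inr i"] by auto
  note meas [measurable]

  \<comment> \<open>The Gaussian row, the measurements and their difference\<close>
  define row where "row v \<omega> = (\<Sum>j\<in>UNIV. A \<omega> $ r $ j * v $ j)" for v :: "real^'n" and \<omega>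
  have row_meas [measurable]: "row v \<in> borel_measurable M" for v
    unfolding row_def[abs_def] by measurable
  define D where "D = row ((1 / \<Delta>) *\<^sub>R (x - xhat))"
  define Q where "Q \<omega> = quantize (y \<omega>)" for \<omega>
  have row_lin: "row (a *\<^sub>R u + b *\<^sub>R v) \<omega> = a * row u \<omega> + b * row v \<omega>" for a b u v \<omega>
    by (simp add: row_def sum.distrib sum_distrib_left algebra_simps)
  have y_eq: "y \<omega> = row ((1 / \<Delta>) *\<^sub>R x) \<omega> + w \<omega> $ r" and yhat_eq: "yhat \<omega> = row ((1 / \<Delta>) *\<^sub>R xhat) \<omega> + w \<omega> $ r" for \<omega>
    by (simp_all add: assms(9,10) measurement_def matrix_vector_mult_def row_def sum_distrib_left sum_divide_distrib)
  have yD: "yhat \<omega> + D \<omega> = y \<omega>" for \<omega>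
    unfolding y_eq yhat_eq D_def scaleR_diff_right
    by (simp add: row_def sum.distrib[symmetric] sum_subtractf algebra_simps)
  have [measurable]: "y \<in> borel_measurable M" "yhat \<in> borel_measurable M" "D \<in> borel_measurable M"
    unfolding y_eq[abs_def] yhat_eq[abs_def] D_def by measurable
  have Q_meas [measurable]: "Q \<in> measurable M (count_space UNIV)" unfolding Q_def by measurable
  have q_eq: "q \<omega> = (\<lambda>i. kth_bit i (Q \<omega>))" for \<omega>
    by (simp add: fun_eq_iff assms(11) Q_def)

  \<comment> \<open>\<open>Z\<close> collects the Gaussian entries of row \<open>r\<close> and
    \<open>W\<close> the dither entry. \<open>D\<close> and the Gaussian part of \<open>yhat\<close>
    are functions of \<open>Z\<close>, which is independent of \<open>W\<close>.\<close>
  define I where "I = (\<lambda>j. Inl (r, j) :: ('m \<times> 'n) + 'm) ` UNIV"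
  define Z where "Z \<omega> = restrict (\<lambda>i. ?X i \<omega>) I" for \<omega>
  define rowZ where "rowZ v z = (\<Sum>j\<in>UNIV. z (Inl (r, j)) * v $ j)" for v :: "real^'n" and z :: "('m \<times> 'n) + 'm \<Rightarrow> real"
  have rowZ: "rowZ v (Z \<omega>) = row v \<omega>" for v \<omega>
    by (simp add: rowZ_def row_def Z_def I_def)
  have rowZ_meas [measurable]: "rowZ v \<in> borel_measurable (Pi\<^sub>M I (\<lambda>_. borel))" for v
  proof -
    have "(\<lambda>z. z (Inl (r, j))) \<in> borel_measurable (Pi\<^sub>M I (\<lambda>_. borel))" for j
      by (rule measurable_component_singleton) (simp add: I_def)
    then show ?thesis unfolding rowZ_def[abs_def] by measurable
  qed
  define W where "W \<omega> = restrict (\<lambda>i. ?X i \<omega>) {Inr r}" for \<omega>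
  have indZ: "indep_var (Pi\<^sub>M {Inr r} (\<lambda>_. borel)) W (Pi\<^sub>M I (\<lambda>_. borel)) Z"
    unfolding Z_def W_def by (rule indep_var_restrict[OF ind]) (auto simp: I_def)
  have W_eq: "W \<omega> (Inr r) = w \<omega> $ r" for \<omega> by (simp add: W_def)
  have W_meas: "(\<lambda>z. z (Inr r)) \<in> borel_measurable (Pi\<^sub>M {Inr r :: ('m \<times> 'n) + 'm} (\<lambda>_. borel))"
    by (rule measurable_component_singleton) simp
  have wW: "distributed M lborel (\<lambda>\<omega>. W \<omega> (Inr r)) (indicator {-1..<0})"
    unfolding W_eq by (rule w)

  have yhat_tie: "AE \<omega> in M. 2 * yhat \<omega> \<notin> \<int>"
    using AE_dither_not_half_integer[OF wW indZ W_meas rowZ_meas, of "(1 / \<Delta>) *\<^sub>R xhat"] by (simp add: rowZ yhat_eq W_eq)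
  have "AE \<omega> in M. 2 * y \<omega> \<notin> \<int>"
    using AE_dither_not_half_integer[OF wW indZ W_meas rowZ_meas, of "(1 / \<Delta>) *\<^sub>R x"] by (simp add: rowZ y_eq W_eq)
  \<comment> \<open>The integer shift may vary with \<open>\<omega>\<close>, as needed when
    \<open>y\<close> is translated by \<open>- \<lfloor>yhat \<omega>\<rfloor>\<close>.\<close>
  then have y_tie: "AE \<omega> in M. y \<omega> + of_int (n \<omega>) + 1 / 2 \<notin> \<int>" for n
  proof eventually_elim
    case (elim \<omega>)
    show ?case
    proof
      assume "y \<omega> + of_int (n \<omega>) + 1 / 2 \<in> \<int>"
      then have "2 * (y \<omega> + of_int (n \<omega>) + 1 / 2) - of_int (2 * n \<omega> + 1) \<in> \<int>" by (intro Ints_diff Ints_mult) auto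
      then show False using elim by (simp add: algebra_simps)
    qed
  qed

  \<comment> \<open>The characteristic function of the prediction error\<close>
  have \<epsilon>: "norm ((t / \<Delta>) *\<^sub>R (x - xhat)) = \<bar>t\<bar> * \<epsilon> / \<Delta>" for t
    using \<Delta> by (simp add: assms(8))
  have char_D: "expectation (\<lambda>\<omega>. iexp (t * D \<omega>)) = of_real (exp (- (1 / 2) * (s * t)\<^sup>2))" for t
  proof -
    have "(\<sigma> * norm ((t / \<Delta>) *\<^sub>R (x - xhat)))\<^sup>2 = (s * t)\<^sup>2"
      unfolding \<epsilon> by (simp add: s_def power_mult_distrib power_divide mult_ac)
    moreover have "row ((t / \<Delta>) *\<^sub>R (x - xhat)) \<omega> = t * D \<omega>" for \<omega>
      using row_lin[of t "(1 / \<Delta>) *\<^sub>R (x - xhat)" 0 0 \<omega>] by (simp add: D_def)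
    ultimately show ?thesis
      using gaussian_row_char[OF \<sigma> A ind, of r "(t / \<Delta>) *\<^sub>R (x - xhat)" 0]
      unfolding row_def[symmetric] by (simp add: prob_space)
  qed

  \<comment> \<open>The claimed likelihood and the error event in terms of \<open>yhat\<close> and
    \<open>Q\<close>\<close>
  define g where "g \<omega> = A2 \<sigma> \<epsilon> \<Delta> k (c \<omega>) / (A1 \<sigma> \<epsilon> \<Delta> k (c \<omega>) + A2 \<sigma> \<epsilon> \<Delta> k (c \<omega>))" for \<omega>
  have A2_rescale: "A2 \<sigma> \<epsilon> \<Delta> k d = A2 s 1 1 k d" for d
    unfolding A2_def s_def by (rule A1_rescale)
  have g_eq: "g \<omega> = likelihood s k (centered_rem k (yhat \<omega> - of_int (Q \<omega>)))" for \<omega>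
    unfolding g_def likelihood_def assms(13) q_eq consistent_dist_kth_bit A2_rescale A1_rescale[of \<sigma> \<epsilon> \<Delta>] s_def[symmetric]
    by (simp only: A1_abs A2_abs[OF k])
  define offset where "offset \<omega> = yhat \<omega> - of_int (closest_consistent k (yhat \<omega>) (q \<omega>))" for \<omega>
  have abs_offset: "\<bar>offset \<omega>\<bar> = \<bar>centered_rem k (yhat \<omega> - of_int (Q \<omega>))\<bar>" for \<omega>
    unfolding offset_def q_eq by (rule abs_diff_closest_consistent)
  \<comment> \<open>By symmetry in the sign this holds at every \<open>\<omega>\<close>, ties
    included, so \<open>g\<close> is measurable for the sigma-algebra of the offset itself and not
    only up to null sets.\<close>
  have g_offset: "g \<omega> = likelihood s k \<bar>offset \<omega>\<bar>" for \<omega>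
    unfolding g_eq abs_offset likelihood_def by (simp only: A1_abs A2_abs[OF k])
  have offset_AE: "AE \<omega> in M. offset \<omega> = centered_rem k (yhat \<omega> - of_int (Q \<omega>))"
    using yhat_tie by eventually_elim
      (simp add: offset_def q_eq closest_consistent_eq_nearest diff_nearest)
  have closest_meas [measurable]: "(\<lambda>\<omega>. closest_consistent k (yhat \<omega>) (q \<omega>)) \<in> measurable M (count_space UNIV)"
    unfolding q_eq by (rule measurable_compose_countable[where g = Q]) measurable
  have offset_meas [measurable]: "offset \<in> borel_measurable M"
    unfolding offset_def[abs_def] by measurable
  have kth_meas [measurable]: "(\<lambda>\<omega>. kth_bit i (Q \<omega>)) \<in> measurable M (count_space UNIV)" for i
    by measurable
  have E_meas [measurable]: "E \<in> sets M"
    unfolding assms(14) assms(12) predicted_bit_def q_eq[unfolded fun_eq_iff, rule_format, of _ k]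
    unfolding kth_bit_def by measurable
  have E_AE: "AE \<omega> in M. \<omega> \<in> E \<longleftrightarrow> odd (step_index k (yhat \<omega> - of_int (Q \<omega>)))"
    using yhat_tie AE_space
  proof eventually_elim
    case (elim \<omega>)
    then show ?case
      using predicted_bit_neq_iff[of "yhat \<omega>" k "Q \<omega>"] by (simp add: assms(14) assms(12) q_eq)
  qed

  \<comment> \<open>Conditioning on the offset\<close>
  have "AE \<omega> in M. real_cond_exp M (sigma_offset M k yhat q) (indicator E) \<omega> = g \<omega>"
  proof -
    define U where "U \<omega> = frac (yhat \<omega>)" for \<omega>
    \<comment> \<open>The integer translation from \<open>yhat\<close> to its fractional part; it
      moves \<open>y\<close> and its quantized value equally, so the difference in
      \<open>diff\<close> is preserved.\<close>
    define m where "m \<omega> = - \<lfloor>yhat \<omega>\<rfloor>" for \<omega>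
    have UD: "U \<omega> + D \<omega> = y \<omega> + of_int (m \<omega>)" for \<omega>
      using yD[of \<omega>] by (simp add: U_def m_def frac_def)
    have QU: "quantize (U \<omega> + D \<omega>) = Q \<omega> + m \<omega>" for \<omega>
    proof -
      have "U \<omega> + D \<omega> + 1 / 2 = (y \<omega> + 1 / 2) + of_int (m \<omega>)" by (simp add: UD)
      then show ?thesis unfolding quantize_def Q_def by (simp only: floor_add_int)
    qed
    have diff: "U \<omega> - of_int (quantize (U \<omega> + D \<omega>)) = yhat \<omega> - of_int (Q \<omega>)" for \<omega>
      unfolding QU by (simp add: U_def m_def frac_def)
    have [measurable]: "frac \<in> borel_measurable (borel :: real measure)" unfolding frac_def[abs_def] by measurable
    have U_meas: "random_variable borel U" unfolding U_def[abs_def] by measurable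
    have trig: "expectation (\<lambda>\<omega>. \<psi> (U \<omega>) * \<xi> (D \<omega>)) = expectation (\<lambda>\<omega>. \<psi> (U \<omega>)) * expectation (\<lambda>\<omega>. \<xi> (D \<omega>))"
      if [measurable]: "\<psi> \<in> borel_measurable borel" "\<xi> \<in> borel_measurable borel" and b: "\<And>u. \<bar>\<psi> u\<bar> \<le> 1" "\<And>u. \<bar>\<xi> u\<bar> \<le> 1" for \<psi> \<xi> :: "real \<Rightarrow> real"
    proof -
      have *: "expectation (\<lambda>\<omega>. \<psi> (U \<omega>) * \<xi> (D \<omega>)) = (LINT x|lborel. indicator {0..<1} x * \<psi> x) * expectation (\<lambda>\<omega>. \<xi> (D \<omega>))"
        if [measurable]: "\<xi> \<in> borel_measurable borel" and b: "\<And>u. \<bar>\<xi> u\<bar> \<le> 1" for \<xi> :: "real \<Rightarrow> real"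
        using expectation_frac_dither[OF wW indZ W_meas, of "rowZ ((1 / \<Delta>) *\<^sub>R xhat)" "\<lambda>z. \<xi> (rowZ ((1 / \<Delta>) *\<^sub>R (x - xhat)) z)" \<psi>] b \<open>\<And>u. \<bar>\<psi> u\<bar> \<le> 1\<close>
        by (simp add: rowZ U_def yhat_eq D_def W_eq)
      \<comment> \<open>The instance with the constant 1 identifies the integral over
        \<open>[0, 1)\<close> as the expectation of \<open>\<psi> (U)\<close>.\<close>
      show ?thesis using *[of \<xi>] *[of "\<lambda>_. 1"] b by (simp add: prob_space)
    qed
    have D_trig: "expectation (\<lambda>\<omega>. cos (t * D \<omega>)) = exp (- (1 / 2) * (s * t)\<^sup>2) \<and> expectation (\<lambda>\<omega>. sin (t * D \<omega>)) = 0" for t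
    proof -
      \<comment> \<open>With the constant 0 in the role of \<open>U\<close>, the joint formula
        yields just the real and imaginary parts of the characteristic function of
        \<open>D\<close>.\<close>
      have joint: "expectation (\<lambda>\<omega>. iexp (\<alpha> * 0 + t * D \<omega>)) = expectation (\<lambda>\<omega>. iexp (\<alpha> * 0)) * of_real (exp (- (1 / 2) * (s * t)\<^sup>2))" for \<alpha> t
        using char_D[of t] by (simp add: prob_space)
      show ?thesis
        using trig_moments_of_joint_char[of "\<lambda>_. 0" D "\<lambda>t. exp (- (1 / 2) * (s * t)\<^sup>2)" "\<lambda>_. 1" t, OF _ _ joint]
        by (simp add: prob_space)
    qed
    have U_trig: "expectation (\<lambda>\<omega>. \<psi> (U \<omega>) * cos (t * D \<omega>)) = expectation (\<lambda>\<omega>. \<psi> (U \<omega>)) * exp (- (1 / 2) * (s * t)\<^sup>2)"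
        "expectation (\<lambda>\<omega>. \<psi> (U \<omega>) * sin (t * D \<omega>)) = 0"
      if "\<psi> \<in> borel_measurable borel" "\<And>u. \<bar>\<psi> u\<bar> \<le> 1" for \<psi> t
      using trig[of \<psi> "\<lambda>d. cos (t * d)"] trig[of \<psi> "\<lambda>d. sin (t * d)"] D_trig[of t] that by simp_all
    interpret noise_prediction M U D s k
      using U_trig k U_meas y_tie[of m] by unfold_locales (simp_all add: UD)
    show ?thesis
    proof (rule real_cond_exp_error)
      have sp: "offset \<in> space M \<rightarrow> space borel" by simp
      show "subalgebra M (sigma_offset M k yhat q)"
        unfolding subalgebra_def sigma_offset_def offset_def[symmetric]
        using sets_vimage_algebra2[OF sp] measurable_sets[OF offset_meas] by (auto simp: Int_commute)
      show "g \<in> borel_measurable (sigma_offset M k yhat q)"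
      proof -
        have "offset \<in> borel_measurable (sigma_offset M k yhat q)"
          unfolding sigma_offset_def offset_def[symmetric] by (rule measurable_vimage_algebra1) simp
        then show ?thesis unfolding g_offset[abs_def] by measurable
      qed
      show "\<exists>S. (\<forall>\<rho>. S \<rho> \<in> sets borel) \<and> (AE \<omega> in M. \<omega> \<in> B \<longleftrightarrow> U \<omega> \<in> S (quantize (U \<omega> + D \<omega>) mod 2 ^ (k - 1)))"
        if B: "B \<in> sets (sigma_offset M k yhat q)" for B
      proof -
        obtain T where T: "T \<in> sets borel" "B = offset -` T \<inter> space M"
          using B unfolding sigma_offset_def offset_def[symmetric] sets_vimage_algebra2[OF sp] by auto
        \<comment> \<open>Outside ties the offset is the centered remainder, which depends only on
          \<open>U\<close> and the residue of the translated quantizer value.\<close>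
        have "AE \<omega> in M. \<omega> \<in> B \<longleftrightarrow> U \<omega> \<in> {u. centered_rem k (u - of_int (quantize (U \<omega> + D \<omega>) mod 2 ^ (k - 1))) \<in> T}"
          using offset_AE AE_space by eventually_elim (simp add: T(2) centered_rem_mod diff del: One_nat_def)
        moreover have "{u. centered_rem k (u - of_int \<rho>) \<in> T} \<in> sets borel" for \<rho> :: int
        proof -
          have "(\<lambda>u. centered_rem k (u - of_int \<rho>)) -` T \<inter> space borel \<in> sets borel"
            by (rule measurable_sets[OF _ T(1)]) measurable
          then show ?thesis by (simp add: vimage_def)
        qed
        ultimately show ?thesis
          by (intro exI[of _ "\<lambda>\<rho>. {u. centered_rem k (u - of_int \<rho>) \<in> T}"]) auto
      qed
    qed (use E_AE in \<open>simp_all add: diff g_eq\<close>)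
  qed

  \<comment> \<open>Conditioning on the prediction and the known bits, in the orthogonal
    case\<close>
  moreover have "AE \<omega> in M. real_cond_exp M (sigma_known M k yhat q) (indicator E) \<omega> = g \<omega>"
    if orth: "xhat \<bullet> (x - xhat) = 0"
  proof -
    have joint: "expectation (\<lambda>\<omega>. iexp (\<alpha> * yhat \<omega> + t * D \<omega>)) = expectation (\<lambda>\<omega>. iexp (\<alpha> * yhat \<omega>)) * of_real (exp (- (1 / 2) * (s * t)\<^sup>2))" for \<alpha> t
    proof -
      \<comment> \<open>The coefficient vector of \<open>\<alpha> * yhat + t * D\<close>, with
        \<open>\<gamma> 0\<close> belonging to \<open>yhat\<close> alone. Orthogonality enters
        through Pythagoras, which splits the exponent and so the characteristic function.\<close>
      define \<gamma> where "\<gamma> t = (\<alpha> / \<Delta>) *\<^sub>R xhat + (t / \<Delta>) *\<^sub>R (x - xhat)" for t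
      have row_\<gamma>: "row (\<gamma> t) \<omega> + \<alpha> * w \<omega> $ r = \<alpha> * yhat \<omega> + t * D \<omega>" for t \<omega>
        using row_lin[of \<alpha> "(1 / \<Delta>) *\<^sub>R xhat" t "(1 / \<Delta>) *\<^sub>R (x - xhat)" \<omega>]
        by (simp add: \<gamma>_def yhat_eq D_def algebra_simps)
      have "orthogonal ((\<alpha> / \<Delta>) *\<^sub>R xhat) ((t / \<Delta>) *\<^sub>R (x - xhat))" for t
        using orth by (simp add: orthogonal_def)
      then have pyth: "(norm (\<gamma> t))\<^sup>2 = (norm ((\<alpha> / \<Delta>) *\<^sub>R xhat))\<^sup>2 + (\<bar>t\<bar> * \<epsilon> / \<Delta>)\<^sup>2" for t
        unfolding \<gamma>_def \<epsilon>[symmetric] by (rule norm_add_Pythagorean)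
      have "(\<sigma> * norm (\<gamma> t))\<^sup>2 = (\<sigma> * norm (\<gamma> 0))\<^sup>2 + (s * t)\<^sup>2"
        unfolding power_mult_distrib pyth s_def
        by (simp add: power_mult_distrib power_divide distrib_left mult_ac)
      then have "of_real (exp (- (1 / 2) * (\<sigma> * norm (\<gamma> t))\<^sup>2))
          = complex_of_real (exp (- (1 / 2) * (\<sigma> * norm (\<gamma> 0))\<^sup>2)) * of_real (exp (- (1 / 2) * (s * t)\<^sup>2))"
        unfolding of_real_mult[symmetric] exp_add[symmetric] by (simp add: algebra_simps)
      then show ?thesis
        using gaussian_row_char[OF \<sigma> A ind, of r "\<gamma> t" \<alpha>] gaussian_row_char[OF \<sigma> A ind, of r "\<gamma> 0" \<alpha>]
        unfolding row_def[symmetric] row_\<gamma> by simp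
    qed
    interpret noise_prediction M yhat D s k
      using trig_moments_of_joint_char[OF _ _ joint] k y_tie[of "\<lambda>_. 0"]
      by unfold_locales (simp_all add: yD)
    define N :: "(real \<times> (nat \<Rightarrow> int)) measure" where "N = borel \<Otimes>\<^sub>M (\<Pi>\<^sub>M i\<in>{1..<k}. count_space UNIV)"
    define known where "known \<omega> = (yhat \<omega>, \<lambda>i\<in>{1..<k}. q \<omega> i)" for \<omega>
    have known_meas: "known \<in> measurable M N"
      unfolding known_def[abs_def] N_def q_eq by measurable
    have sp: "known \<in> space M \<rightarrow> space N" using measurable_space[OF known_meas] by auto
    have F: "sigma_known M k yhat q = vimage_algebra (space M) known N"
      by (simp add: sigma_known_def known_def[abs_def] N_def)
    show ?thesis
    proof (rule real_cond_exp_error)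
      show "subalgebra M (sigma_known M k yhat q)"
        unfolding subalgebra_def F
        using sets_vimage_algebra2[OF sp] measurable_sets[OF known_meas] by (auto simp: Int_commute)
      show "g \<in> borel_measurable (sigma_known M k yhat q)"
      proof -
        \<comment> \<open>Exactly one \<open>\<rho>\<close> in \<open>{0..<P}\<close> has the known
          bits, namely \<open>Q \<omega> mod P\<close>; the sum selects it and exhibits
          \<open>g\<close> as a measurable function of \<open>known\<close>.\<close>
        define G where "G p = (\<Sum>\<rho>\<in>{0..<P}. of_bool (\<forall>i\<in>{1..<k}. snd p i = kth_bit i \<rho>) * likelihood s k (centered_rem k (fst p - of_int \<rho>)))"
          for p :: "real \<times> (nat \<Rightarrow> int)"
        have "(\<lambda>p. \<forall>i\<in>{1..<k}. snd p i = kth_bit i \<rho>) \<in> measurable N (count_space UNIV)" for \<rho>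
          unfolding N_def by measurable
        then have G: "G \<in> borel_measurable N"
          unfolding G_def[abs_def] of_bool_def unfolding N_def by measurable
        have "g = (\<lambda>\<omega>. G (known \<omega>))"
        proof
          fix \<omega>
          have "(\<forall>i\<in>{1..<k}. snd (known \<omega>) i = kth_bit i \<rho>) \<longleftrightarrow> Q \<omega> mod P = \<rho>" if "\<rho> \<in> {0..<P}" for \<rho>
          proof -
            have "(\<forall>i\<in>{1..<k}. snd (known \<omega>) i = kth_bit i \<rho>) \<longleftrightarrow> consistent k (\<lambda>i. kth_bit i \<rho>) (Q \<omega>)"
              by (auto simp: known_def q_eq consistent_def)
            then show ?thesis using that by (simp add: consistent_kth_bit_iff mod_eq_dvd_iff[symmetric] P_def)
          qed
          then have "G (known \<omega>) = (\<Sum>\<rho>\<in>{0..<P}. of_bool (Q \<omega> mod P = \<rho>) * likelihood s k (centered_rem k (yhat \<omega> - of_int \<rho>)))"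
            unfolding G_def by (intro sum.cong) (simp_all add: known_def)
          also have "\<dots> = (\<Sum>\<rho>\<in>{Q \<omega> mod P}. of_bool (Q \<omega> mod P = \<rho>) * likelihood s k (centered_rem k (yhat \<omega> - of_int \<rho>)))"
            by (rule sum.mono_neutral_right) (use P in auto)
          also have "\<dots> = g \<omega>" by (simp add: P_def centered_rem_mod g_eq del: One_nat_def)
          finally show "g \<omega> = G (known \<omega>)" by simp
        qed
        moreover have "(\<lambda>\<omega>. G (known \<omega>)) \<in> borel_measurable (sigma_known M k yhat q)"
          unfolding F by (rule measurable_compose[OF measurable_vimage_algebra1[OF sp] G])
        ultimately show ?thesis by (simp only:)
      qed
      show "\<exists>S. (\<forall>\<rho>. S \<rho> \<in> sets borel) \<and> (AE \<omega> in M. \<omega> \<in> B \<longleftrightarrow> yhat \<omega> \<in> S (quantize (yhat \<omega> + D \<omega>) mod 2 ^ (k - 1)))"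
        if B: "B \<in> sets (sigma_known M k yhat q)" for B
      proof -
        obtain T where T: "T \<in> sets N" "B = known -` T \<inter> space M"
          using B unfolding F sets_vimage_algebra2[OF sp] by auto
        \<comment> \<open>The section of \<open>T\<close> at the bits of \<open>\<rho>\<close>; by
          \<open>kth_bit_mod\<close> the known bits of \<open>Q\<close> are those of its
          residue.\<close>
        define S where "S \<rho> = {u. (u, \<lambda>i\<in>{1..<k}. kth_bit i \<rho>) \<in> T}" for \<rho>
        have "known \<omega> = (yhat \<omega>, \<lambda>i\<in>{1..<k}. kth_bit i (Q \<omega> mod 2 ^ (k - 1)))" for \<omega>
          by (auto simp: known_def q_eq kth_bit_mod fun_eq_iff restrict_def simp del: One_nat_def)
        then have "\<omega> \<in> B \<longleftrightarrow> yhat \<omega> \<in> S (quantize (yhat \<omega> + D \<omega>) mod 2 ^ (k - 1))" if "\<omega> \<in> space M" for \<omega>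
          using that by (simp add: T(2) S_def yD Q_def)
        moreover have "S \<rho> \<in> sets borel" for \<rho>
        proof -
          have "(\<lambda>u. (u, \<lambda>i\<in>{1..<k}. kth_bit i \<rho>)) \<in> measurable borel N"
            unfolding N_def by (intro measurable_Pair measurable_ident measurable_const) (auto simp: space_PiM)
          from measurable_sets[OF this T(1)] show ?thesis by (simp add: vimage_def S_def)
        qed
        ultimately show ?thesis by (intro exI[of _ S]) auto
      qed
    qed (use E_AE in \<open>simp_all add: yD Q_def[symmetric] g_eq\<close>)
  qed
  ultimately show ?thesis unfolding g_def by blast
qed

end
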